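(* Let $\mu=\sum_{i=1}^m\lambda_i\delta_{u_i}$, where $\lambda_i>0$ for all $i$ and $\{u_1,\dots,u_m\}\subset S^{n-1}$ is not concentrated on any closed hemisphere. Let $G\in\mathcal G_I$ be such that, for some $q\ge n-1$, $$\inf\Big\{\frac{G(t,u)}{t^q}:\ t\ge 1,\ u\in S^{n-1}\Big\}>0.$$ i) If $\varphi\in\mathcal D$ and the first coordinates of $u_1,u_2,\dots,u_m$ are all nonzero, then $$\inf_{Q\in\widehat{\mathcal B}}\ \sum_{i=1}^m\lambda_i\varphi(h_Q(u_i))=0.$$ ii) If $\varphi\in\mathcal I\cup\mathcal D$, then $$\sup_{Q\in\widehat{\mathcal B}}\ \sum_{i=1}^m\lambda_i\varphi(h_Q(u_i))=\infty.$$
   Context: Work in $\mathbb R^n$, $n\ge2$, with inner product $\langle\cdot,\cdot\rangle$, unit ball $B^n$ and unit sphere $S^{n-1}$; $du$ denotes the spherical measure on $S^{n-1}$ (the $(n-1)$-dimensional Hausdorff measure). Coordinates are with respect to the canonical orthonormal basis. $\mathcal K_{(o)}^n$ is the set of compact convex subsets of $\mathbb R^n$ with the origin $o$ in their interiors. For $K\in\mathcal K_{(o)}^n$ and $u\in S^{n-1}$: $h_K(u)=\max_{x\in K}\langle x,u\rangle$, $\rho_K(u)=\max\{\lambda\ge0:\lambda u\in K\}$, and $K^\circ=\{x\in\mathbb R^n:\langle x,y\rangle\le1\ \forall y\in K\}$. $\mathcal I$ is the set of continuous strictly increasing functions $\varphi:(0,\infty)\to(0,\infty)$ with $\lim_{t\to0^+}\varphi(t)=0$,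 $\varphi(1)=1$, $\lim_{t\to\infty}\varphi(t)=\infty$. $\mathcal D$ is the set of continuous strictly decreasing functions $\varphi:(0,\infty)\to(0,\infty)$ with $\lim_{t\to0^+}\varphi(t)=\infty$, $\varphi(1)=1$, $\lim_{t\to\infty}\varphi(t)=0$. $\mathcal G_I$ is the set of continuous $G:(0,\infty)\times S^{n-1}\to(0,\infty)$ such that for each $u\in S^{n-1}$, $t\mapsto G(t,u)$ is strictly increasing with $\lim_{t\to0^+}G(t,u)=0$ and $\lim_{t\to\infty}G(t,u)=\infty$. For $G\in\mathcal G_I$ and $K\in\mathcal K_{(o)}^n$ the homogeneous general dual volume is $\widehat V_G(K)=\inf\{\eta>0:\int_{S^{n-1}}G(\rho_K(u)/\eta,u)\,du\le1\}$, and $$\widehat{\mathcal B}=\{Q\in\mathcal K_{(o)}^n:\widehat V_G(Q^\circ)=\widehat V_G(B^n)\}.$$ $\delta_{u}$ is the Dirac measure at $u$. The set $\{u_1,\dots,u_m\}$ is not concentrated on any closed hemisphere if for every $v\in S^{n-1}$ there is $i$ with $\langle u_i,v\rangle>0$. *)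

theory Defs
  imports "HOL-Analysis.Analysis"
begin

(* Hausdorff measure of dimension s > 0 on the Borel sets of a metric space, with the usual
   normalisation: in dimension n it agrees with Lebesgue measure on R^n, and on hypersurfaces the
   (n - 1)-dimensional measure is the surface area.  Since the library diameter of an unbounded
   set carries no information, the covering sets are required to be bounded; finite covers are
   included, as the empty set has diameter 0. *)

definition hausdorff_content :: "real \<Rightarrow> real \<Rightarrow> 'a::metric_space set \<Rightarrow> ennreal" where
  "hausdorff_content s \<delta> A =
     (INF E \<in> {E :: nat \<Rightarrow> 'a set. A \<subseteq> (\<Union>i. E i) \<and> (\<forall>i. bounded (E i) \<and> diameter (E i) \<le> \<delta>)}.
        \<Sum>i. ennreal (unit_ball_vol s * (diameter (E i) / 2) powr s))"

definition hausdorff_outer :: "real \<Rightarrow> 'a::metric_space set \<Rightarrow> ennreal" where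
  "hausdorff_outer s A = (SUP \<delta> \<in> {0<..}. hausdorff_content s \<delta> A)"

definition hausdorff_measure :: "real \<Rightarrow> 'a::metric_space measure" where
  "hausdorff_measure s = measure_of UNIV (sets borel) (hausdorff_outer s)"

definition spherical_measure :: "(real ^ 'n) measure" where
  "spherical_measure =
     restrict_space (hausdorff_measure (real CARD('n) - 1)) (sphere 0 1)"

definition convex_bodies_o :: "(real ^ 'n) set set" where
  "convex_bodies_o = {K. compact K \<and> convex K \<and> 0 \<in> interior K}"

definition support_fun :: "(real ^ 'n) set \<Rightarrow> real ^ 'n \<Rightarrow> real" where
  "support_fun K u = (SUP x \<in> K. x \<bullet> u)"

definition radial_fun :: "(real ^ 'n) set \<Rightarrow> real ^ 'n \<Rightarrow> real" where
  "radial_fun K u = Sup {t. 0 \<le> t \<and> t *\<^sub>R u \<in> K}"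

definition polar_body :: "(real ^ 'n) set \<Rightarrow> (real ^ 'n) set" where
  "polar_body K = {x. \<forall>y \<in> K. x \<bullet> y \<le> 1}"

(* Functions on (0, infinity) are total functions on the reals, constrained on {0<..} only. *)

definition class_I :: "(real \<Rightarrow> real) set" where
  "class_I = {\<phi>. (\<forall>t > 0. \<phi> t > 0) \<and> continuous_on {0<..} \<phi> \<and> strict_mono_on {0<..} \<phi> \<and>
     (\<phi> \<longlongrightarrow> 0) (at_right 0) \<and> \<phi> 1 = 1 \<and> filterlim \<phi> at_top at_top}"

definition class_D :: "(real \<Rightarrow> real) set" where
  "class_D = {\<phi>. (\<forall>t > 0. \<phi> t > 0) \<and> continuous_on {0<..} \<phi> \<and>
     strict_antimono_on {0<..} \<phi> \<and>
     filterlim \<phi> at_top (at_right 0) \<and> \<phi> 1 = 1 \<and> (\<phi> \<longlongrightarrow> 0) at_top}"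

definition class_G_I :: "(real \<Rightarrow> real ^ 'n \<Rightarrow> real) set" where
  "class_G_I = {G. (\<forall>t > 0. \<forall>u \<in> sphere 0 1. G t u > 0) \<and>
     continuous_on ({0<..} \<times> sphere 0 1) (\<lambda>(t, u). G t u) \<and>
     (\<forall>u \<in> sphere 0 1. strict_mono_on {0<..} (\<lambda>t. G t u) \<and>
        ((\<lambda>t. G t u) \<longlongrightarrow> 0) (at_right 0) \<and> filterlim (\<lambda>t. G t u) at_top at_top)}"

definition dual_volume :: "(real \<Rightarrow> real ^ 'n \<Rightarrow> real) \<Rightarrow> (real ^ 'n) set \<Rightarrow> real" where
  "dual_volume G K =
     Inf {\<eta>. 0 < \<eta> \<and> (\<integral>\<^sup>+u. ennreal (G (radial_fun K u / \<eta>) u) \<partial>spherical_measure) \<le> 1}"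

definition normalized_bodies :: "(real \<Rightarrow> real ^ 'n \<Rightarrow> real) \<Rightarrow> (real ^ 'n) set set" where
  "normalized_bodies G =
     {Q \<in> convex_bodies_o. dual_volume G (polar_body Q) = dual_volume G (cball 0 1)}"

definition not_in_closed_hemisphere :: "(real ^ 'n) set \<Rightarrow> bool" where
  "not_in_closed_hemisphere U \<longleftrightarrow> (\<forall>v \<in> sphere 0 1. \<exists>u \<in> U. u \<bullet> v > 0)"

end

theory Submission
  imports Defs
begin

text \<open>
  Passing to polar bodies, \<open>h\<^bsub>K\<^esub>\<close> of the polar of \<open>K\<close> is \<open>1 / \<rho>\<^bsub>K\<^esub>\<close>, and every \<open>K\<close> yields a normalized
  body, the polar of \<open>K\<close> scaled by \<open>V(K) / V(B)\<close>, because the dual volume \<open>V\<close> is homogeneous.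
  The slab pieces \<open>{x. \<bar>x \<bullet> w\<bar> \<le> 1 \<and> norm x \<le> R}\<close> have \<open>V \<rightarrow> \<infinity>\<close>: since \<open>q \<ge> 1\<close>, the integral is at
  least a multiple of the integral of \<open>min (1 / \<bar>v \<bullet> w\<bar>) R\<close>, which diverges logarithmically.  Hence
  some normalized body has \<open>h(v) \<ge> Y * \<bar>v \<bullet> w\<bar>\<close> for all \<open>v\<close>, with \<open>Y\<close> as large as desired.  Thin
  bodies around the segment from \<open>-w\<close> to \<open>w\<close> have \<open>V \<rightarrow> 0\<close> by dominated convergence, which gives normalized
  bodies with \<open>h(w)\<close> as small as desired.  For the spherical measure one only needs that it is a
  finite measure without atoms giving \<open>{v. \<bar>v \<bullet> w\<bar> \<le> a}\<close> mass at least \<open>c * a\<close>; the upper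
  bound comes from packing balls into a shell, the lower one from comparison with the volume of cones.
\<close>

section \<open>Hausdorff measure\<close>

abbreviation hausdorff_weight :: "real \<Rightarrow> 'a::metric_space set \<Rightarrow> ennreal" where
  "hausdorff_weight s E \<equiv> ennreal (unit_ball_vol s * (diameter E / 2) powr s)"

lemma hausdorff_content_le:
  assumes "A \<subseteq> (\<Union>i. E i)" "\<And>i::nat. bounded (E i)" "\<And>i. diameter (E i) \<le> \<delta>"
  shows "hausdorff_content s \<delta> A \<le> (\<Sum>i. hausdorff_weight s (E i))"
  unfolding hausdorff_content_def using assms by (intro INF_lower) auto

lemma hausdorff_content_less:
  assumes "hausdorff_content s \<delta> A < c"
  shows "\<exists>E::nat \<Rightarrow> _. A \<subseteq> (\<Union>i. E i) \<and> (\<forall>i. bounded (E i) \<and> diameter (E i) \<le> \<delta>) \<and>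
    (\<Sum>i. hausdorff_weight s (E i)) < c"
  using assms unfolding hausdorff_content_def INF_less_iff by auto

lemma hausdorff_content_mono: "A \<subseteq> B \<Longrightarrow> hausdorff_content s \<delta> A \<le> hausdorff_content s \<delta> B"
  unfolding hausdorff_content_def by (rule INF_superset_mono) auto

lemma hausdorff_content_antimono:
  "\<delta>' \<le> \<delta> \<Longrightarrow> hausdorff_content s \<delta> A \<le> hausdorff_content s \<delta>' A"
  unfolding hausdorff_content_def by (rule INF_superset_mono) (auto intro: order_trans)

text \<open>Each \<open>A n\<close> is covered with an error of at most
  \<open>e * (1/2) ^ Suc n\<close>. Enumerated by \<open>prod_decode\<close>, all these covering
  sets together cover the union, and the errors add up to \<open>e\<close>.\<close>

lemma hausdorff_content_subadditive:
  "hausdorff_content s \<delta> (\<Union>i. A i) \<le> (\<Sum>i::nat. hausdorff_content s \<delta> (A i))"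
proof (rule ennreal_le_epsilon)
  fix e :: real
  assume "0 < e" "(\<Sum>i. hausdorff_content s \<delta> (A i)) < top"
  \<comment> \<open>The strict inequality needs every content to be finite, which follows from the
    finiteness of the sum.\<close>
  then have *: "hausdorff_content s \<delta> (A n) < hausdorff_content s \<delta> (A n) + e * (1/2)^Suc n" for n
    by (auto simp add: less_top dest!: ennreal_suminf_lessD)
  obtain E :: "nat \<Rightarrow> nat \<Rightarrow> _" where E: "\<And>n. A n \<subseteq> (\<Union>i. E n i)"
    "\<And>n i. bounded (E n i) \<and> diameter (E n i) \<le> \<delta>"
    and le: "\<And>n. (\<Sum>i. hausdorff_weight s (E n i)) < hausdorff_content s \<delta> (A n) + e * (1/2)^Suc n"
    using hausdorff_content_less[OF *] by metis
  define C where "C = (\<lambda>k. case_prod E (prod_decode k))"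
  have "(\<Union>i. A i) \<subseteq> (\<Union>k. C k)"
  proof
    fix x assume "x \<in> (\<Union>i. A i)"
    then obtain n i where "x \<in> E n i" using E(1) by blast
    then have "x \<in> C (prod_encode (n, i))" by (simp add: C_def)
    then show "x \<in> (\<Union>k. C k)" by blast
  qed
  then have "hausdorff_content s \<delta> (\<Union>i. A i) \<le> (\<Sum>k. hausdorff_weight s (C k))"
    using E(2) by (intro hausdorff_content_le) (auto simp: C_def split: prod.split)
  also have "\<dots> = (\<Sum>k. (\<lambda>(n, i). hausdorff_weight s (E n i)) (prod_decode k))"
    by (simp add: C_def case_prod_beta)
  also have "\<dots> = (\<Sum>n. \<Sum>i. hausdorff_weight s (E n i))"
    by (intro suminf_ennreal_2dimen) auto
  also have "\<dots> \<le> (\<Sum>n. hausdorff_content s \<delta> (A n) + e * (1/2) ^ Suc n)"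
    using le by (intro suminf_le) (auto intro: less_imp_le)
  also have "\<dots> = (\<Sum>n. hausdorff_content s \<delta> (A n)) + (\<Sum>n. ennreal e * ennreal ((1/2) ^ Suc n))"
    using \<open>0 < e\<close> by (subst suminf_add[symmetric])
      (auto simp del: ennreal_suminf_cmult simp add: ennreal_mult[symmetric])
  also have "\<dots> = (\<Sum>n. hausdorff_content s \<delta> (A n)) + e"
    unfolding ennreal_suminf_cmult
    by (subst suminf_ennreal_eq[OF zero_le_power power_half_series]) auto
  finally show "hausdorff_content s \<delta> (\<Union>i. A i) \<le> (\<Sum>i. hausdorff_content s \<delta> (A i)) + e" .
qed

lemma hausdorff_content_le_outer: "0 < \<delta> \<Longrightarrow> hausdorff_content s \<delta> A \<le> hausdorff_outer s A"
  unfolding hausdorff_outer_def by (rule SUP_upper) auto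

lemma hausdorff_outer_mono: "A \<subseteq> B \<Longrightarrow> hausdorff_outer s A \<le> hausdorff_outer s B"
  unfolding hausdorff_outer_def by (intro SUP_mono) (auto intro: hausdorff_content_mono)

text \<open>Finitely many singletons cover \<open>A\<close> at every scale. They have diameter 0,
  and the convention \<open>0 powr s = 0\<close> makes their weight vanish for every
  \<open>s\<close>.\<close>

lemma hausdorff_outer_finite_eq_0:
  assumes "finite A"
  shows "hausdorff_outer s A = 0"
proof -
  obtain E :: "nat \<Rightarrow> 'a set" where E: "A \<subseteq> (\<Union>i. E i)" "\<And>i. E i = {} \<or> (\<exists>x. E i = {x})"
  proof (cases "A = {}")
    case True then show ?thesis using that[of "\<lambda>i. {}"] by auto
  next
    case False
    then obtain f :: "nat \<Rightarrow> 'a" where "A = range f"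
      using assms countable_finite uncountable_def by blast
    then show ?thesis using that[of "\<lambda>i. {f i}"] by auto
  qed
  have *: "bounded (E i)" "diameter (E i) = 0" for i
    using E(2)[of i] by (auto simp: diameter_singleton)
  have "hausdorff_content s \<delta> A \<le> 0" if "0 < \<delta>" for \<delta>
    using hausdorff_content_le[OF E(1), of \<delta> s] * that by simp
  then show ?thesis
    unfolding hausdorff_outer_def by (simp add: SUP_eq_iff bot_ennreal)
qed

lemma hausdorff_outer_subadditive:
  "hausdorff_outer s (\<Union>i. A i) \<le> (\<Sum>i::nat. hausdorff_outer s (A i))"
  unfolding hausdorff_outer_def[of s "\<Union>i. A i"]
  by (intro SUP_least order_trans[OF hausdorff_content_subadditive] suminf_le
      hausdorff_content_le_outer) auto

lemma hausdorff_outer_Un: "hausdorff_outer s (A \<union> B) \<le> hausdorff_outer s A + hausdorff_outer s B"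
proof -
  have "hausdorff_outer s (\<Union>i. binaryset A B i) \<le> (\<Sum>i. hausdorff_outer s (binaryset A B i))"
    by (rule hausdorff_outer_subadditive)
  also have "\<dots> = hausdorff_outer s A + hausdorff_outer s B"
    by (rule suminf_binaryset_eq) (simp add: hausdorff_outer_finite_eq_0)
  finally show ?thesis by (simp add: UN_binaryset_eq)
qed

section \<open>Additivity on separated sets, and Caratheodory's criterion\<close>

lemma ennreal_SUP_add_SUP_le:
  fixes f :: "'a \<Rightarrow> ennreal" and g :: "'b \<Rightarrow> ennreal"
  assumes "I \<noteq> {}" "J \<noteq> {}" "\<And>x y. x \<in> I \<Longrightarrow> y \<in> J \<Longrightarrow> f x + g y \<le> c"
  shows "(SUP x\<in>I. f x) + (SUP y\<in>J. g y) \<le> c"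
proof -
  have "(SUP y\<in>J. g y) + f x \<le> c" if "x \<in> I" for x
    by (subst ennreal_SUP_add_left[OF assms(2), symmetric])
      (rule SUP_least, use assms(3)[OF that] in \<open>simp add: add.commute\<close>)
  then show ?thesis
    by (subst ennreal_SUP_add_left[OF assms(1), symmetric]) (intro SUP_least, simp add: add.commute)
qed

text \<open>Covering sets of diameter smaller than the gap meet at most one of the two sets.\<close>
lemma hausdorff_outer_separated:
  assumes "0 < \<eta>" and sep: "\<And>x y. x \<in> A \<Longrightarrow> y \<in> B \<Longrightarrow> \<eta> \<le> dist x y"
  shows "hausdorff_outer s A + hausdorff_outer s B \<le> hausdorff_outer s (A \<union> B)"
  unfolding hausdorff_outer_def[of s A] hausdorff_outer_def[of s B]
proof (rule ennreal_SUP_add_SUP_le)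
  fix \<delta>1 \<delta>2 :: real
  assume "\<delta>1 \<in> {0<..}" "\<delta>2 \<in> {0<..}"
  \<comment> \<open>The two suprema run over independent scales. Contents grow as the scale shrinks,
    so a common smaller scale serves for both; \<open>\<eta> / 2\<close> keeps it strictly below the
    gap.\<close>
  define \<delta> where "\<delta> = min (min \<delta>1 \<delta>2) (\<eta> / 2)"
  have \<delta>: "0 < \<delta>" "\<delta> \<le> \<delta>1" "\<delta> \<le> \<delta>2" "\<delta> < \<eta>"
    using \<open>\<delta>1 \<in> _\<close> \<open>\<delta>2 \<in> _\<close> \<open>0 < \<eta>\<close> by (auto simp: \<delta>_def)
  have "hausdorff_content s \<delta> A + hausdorff_content s \<delta> B \<le> hausdorff_content s \<delta> (A \<union> B)"
    unfolding hausdorff_content_def[of s \<delta> "A \<union> B"]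
  proof (rule INF_greatest, clarify)
    fix E :: "nat \<Rightarrow> 'a set"
    assume cov: "A \<union> B \<subseteq> (\<Union>i. E i)" and E: "\<forall>i. bounded (E i) \<and> diameter (E i) \<le> \<delta>"
    \<comment> \<open>Covering sets that miss \<open>C\<close> are replaced by the empty set, of
      weight 0. As no \<open>E i\<close> meets both \<open>A\<close> and \<open>B\<close>, its
      weight is charged at most once.\<close>
    define F where "F = (\<lambda>C i. if E i \<inter> C = {} then {} else E i)"
    have F: "bounded (F C i)" "diameter (F C i) \<le> \<delta>" for C i
      using E \<delta>(1) by (auto simp: F_def)
    have cover: "A \<subseteq> (\<Union>i. F A i)" "B \<subseteq> (\<Union>i. F B i)"
      using cov by (fastforce simp: F_def)+
    have "E i \<inter> A = {} \<or> E i \<inter> B = {}" for i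
    proof (rule ccontr)
      assume "\<not> ?thesis"
      then obtain x y where "x \<in> E i" "y \<in> E i" "x \<in> A" "y \<in> B" by blast
      moreover have "dist x y \<le> diameter (E i)"
        using E calculation by (intro diameter_bounded_bound) auto
      ultimately show False using sep[of x y] E \<delta>(4) by (smt (verit))
    qed
    then have *: "hausdorff_weight s (F A i) + hausdorff_weight s (F B i) \<le> hausdorff_weight s (E i)"
      for i
      using spec[of _ i] by (auto simp: F_def)
    have "hausdorff_content s \<delta> A + hausdorff_content s \<delta> B
      \<le> (\<Sum>i. hausdorff_weight s (F A i)) + (\<Sum>i. hausdorff_weight s (F B i))"
      using F cover by (intro add_mono hausdorff_content_le) auto
    also have "\<dots> = (\<Sum>i. hausdorff_weight s (F A i) + hausdorff_weight s (F B i))"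
      by (rule suminf_add) auto
    also have "\<dots> \<le> (\<Sum>i. hausdorff_weight s (E i))"
      using * by (intro suminf_le) auto
    finally show "hausdorff_content s \<delta> A + hausdorff_content s \<delta> B \<le> (\<Sum>i. hausdorff_weight s (E i))" .
  qed
  also have "\<dots> \<le> hausdorff_outer s (A \<union> B)"
    using \<delta>(1) by (rule hausdorff_content_le_outer)
  finally show "hausdorff_content s \<delta>1 A + hausdorff_content s \<delta>2 B \<le> hausdorff_outer s (A \<union> B)"
    using hausdorff_content_antimono[OF \<delta>(2)] hausdorff_content_antimono[OF \<delta>(3)]
    by (meson add_mono order_trans)
qed auto

lemma infdist_diff_le_dist: "infdist x F - infdist y F \<le> dist x y"
  using infdist_triangle[of x F y] by simp

text \<open>Every second ring around \<open>F\<close> is separated from the union of the earlier ones.\<close>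
lemma sum_hausdorff_outer_rings_le:
  fixes A F :: "'a::metric_space set"
  defines "R \<equiv> \<lambda>k. {x \<in> A. 1 / (real k + 2) \<le> infdist x F \<and> infdist x F < 1 / (real k + 1)}"
  shows "(\<Sum>j<N. hausdorff_outer s (R (2 * j + a))) \<le> hausdorff_outer s (\<Union>j<N. R (2 * j + a))"
proof (induction N)
  case (Suc N)
  have "(\<Sum>j<Suc N. hausdorff_outer s (R (2 * j + a)))
      \<le> hausdorff_outer s (\<Union>j<N. R (2 * j + a)) + hausdorff_outer s (R (2 * N + a))"
    using Suc by (simp add: add_right_mono)
  also have "\<dots> \<le> hausdorff_outer s ((\<Union>j<N. R (2 * j + a)) \<union> R (2 * N + a))"
  proof (rule hausdorff_outer_separated)
    \<comment> \<open>The earlier rings stay at distance at least \<open>1 / (2 * N + a)\<close>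
      from \<open>F\<close>, the new one below \<open>1 / (2 * N + a + 1)\<close>. For
      \<open>N = 0\<close> the earlier union is empty and the formula can contain
      \<open>1 / 0\<close>, so the gap 1 is taken instead.\<close>
    let ?\<eta> = "1 / (2 * real N + real a) - 1 / (2 * real N + real a + 1)"
    show "0 < (if N = 0 then 1 else ?\<eta>)" by (auto intro!: divide_strict_left_mono)
    fix x y assume "x \<in> (\<Union>j<N. R (2 * j + a))" and y: "y \<in> R (2 * N + a)"
    then obtain j where j: "j < N" "x \<in> R (2 * j + a)" by auto
    have "1 / (2 * real N + real a) \<le> 1 / (real (2 * j + a) + 2)"
      using j(1) by (intro divide_left_mono) auto
    moreover have "1 / (real (2 * j + a) + 2) \<le> infdist x F" using j(2) by (simp add: R_def)
    moreover have "infdist y F < 1 / (2 * real N + real a + 1)" using y by (simp add: R_def)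
    ultimately have "?\<eta> \<le> infdist x F - infdist y F" by simp
    also have "\<dots> \<le> dist x y" by (rule infdist_diff_le_dist)
    finally show "(if N = 0 then 1 else ?\<eta>) \<le> dist x y" using j(1) by simp
  qed
  also have "(\<Union>j<N. R (2 * j + a)) \<union> R (2 * N + a) = (\<Union>j<Suc N. R (2 * j + a))"
    by (auto simp: lessThan_Suc)
  finally show ?case .
qed simp

text \<open>\<open>B k\<close> is separated from \<open>F\<close>, and what \<open>A - F\<close> has
  outside \<open>B k\<close> lies in the rings of index \<open>k\<close> and higher. The rings of
  even index and those of odd index each sum to at most the outer measure of \<open>A\<close>, so
  the series over all rings converges and its tails vanish as \<open>k\<close> grows.\<close>

lemma hausdorff_outer_closed_split:
  fixes A F :: "'a::metric_space set"
  assumes F: "closed F" "F \<noteq> {}"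
  shows "hausdorff_outer s (A \<inter> F) + hausdorff_outer s (A - F) \<le> hausdorff_outer s A"
proof (cases "hausdorff_outer s A = top")
  case False
  define R where
    "R = (\<lambda>k. {x \<in> A. 1 / (real k + 2) \<le> infdist x F \<and> infdist x F < 1 / (real k + 1)})"
  define B where "B = (\<lambda>k::nat. {x \<in> A. 1 / (real k + 1) \<le> infdist x F})"
  let ?H = "hausdorff_outer s"
  have RA: "R k \<subseteq> A" for k by (auto simp: R_def)
  have part: "(\<Sum>j<N. ?H (R (2 * j + a))) \<le> ?H A" for N a
    using sum_hausdorff_outer_rings_le[where s = s and A = A and F = F and a = a and N = N] RA unfolding R_def
    by (auto intro: order_trans[OF _ hausdorff_outer_mono])
  have "(\<Sum>k. ?H (R k)) \<le> ?H A + ?H A"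
  proof (rule suminf_le_const[OF summableI])
    fix N
    have "(\<Sum>k<N. ?H (R k)) \<le> (\<Sum>k<2 * N. ?H (R k))" by (intro sum_mono2) auto
    also have "\<dots> = (\<Sum>j<N. ?H (R (2 * j + 0))) + (\<Sum>j<N. ?H (R (2 * j + 1)))"
      by (induction N) (auto simp: algebra_simps)
    also have "\<dots> \<le> ?H A + ?H A" by (intro add_mono part)
    finally show "(\<Sum>k<N. ?H (R k)) \<le> ?H A + ?H A" .
  qed
  then have fin: "(\<Sum>k. ?H (R k)) \<noteq> top"
    using False by (auto simp: top_unique)
  \<comment> \<open>All terms are finite, so the vanishing of tails can be taken from convergent
    series of reals.\<close>
  have tail: "(\<lambda>k. \<Sum>j. ?H (R (j + k))) \<longlonglongrightarrow> 0"
  proof -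
    have "?H (R k) \<noteq> top" for k
      using False hausdorff_outer_mono[OF RA[of k], of s] by (auto simp: top_unique)
    moreover define r where "r = (\<lambda>k. enn2real (?H (R k)))"
    ultimately have r: "?H (R k) = ennreal (r k)" "0 \<le> r k" for k
      by (auto simp: less_top)
    have "summable r" using fin r by (intro summable_suminf_not_top) auto
    have "(\<Sum>j. ?H (R (j + k))) = ennreal (\<Sum>j. r (j + k))" for k
      using r \<open>summable r\<close> by (simp add: suminf_ennreal2 summable_iff_shift)
    moreover have "(\<lambda>k. ennreal (\<Sum>j. r (j + k))) \<longlonglongrightarrow> ennreal 0"
      by (intro tendsto_ennrealI suminf_exist_split2 \<open>summable r\<close>)
    ultimately show ?thesis by simp
  qed
  have bound: "?H (A \<inter> F) + ?H (A - F) \<le> ?H A + (\<Sum>j. ?H (R (j + k)))" for k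
  proof -
    have "A - F \<subseteq> B k \<union> (\<Union>j. R (j + k))"
    proof
      fix x assume x: "x \<in> A - F"
      then have pos: "0 < infdist x F" using F by (simp add: infdist_pos_not_in_closed)
      show "x \<in> B k \<union> (\<Union>j. R (j + k))"
      proof (cases "x \<in> B k")
        case False
        from False x have lt: "infdist x F < 1 / (real k + 1)" by (simp add: B_def)
        then have "real k + 1 < 1 / infdist x F" using pos by (simp add: field_simps)
        \<comment> \<open>With \<open>t = 1 / infdist x F\<close>, the point \<open>x\<close> lies
          in ring \<open>m\<close> exactly if \<open>m + 1 < t\<close> and
          \<open>t \<le> m + 2\<close>, so \<open>m\<close> is the ceiling of \<open>t\<close> minus
          2.\<close>
        define m where "m = nat (\<lceil>1 / infdist x F\<rceil> - 2)"
        have c: "real_of_int (\<lceil>1 / infdist x F\<rceil>) \<ge> 1 / infdist x F"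
          "real_of_int (\<lceil>1 / infdist x F\<rceil>) < 1 / infdist x F + 1" by linarith+
        have "\<lceil>1 / infdist x F\<rceil> \<ge> int k + 2" using \<open>real k + 1 < 1 / infdist x F\<close> by linarith
        then have m: "k \<le> m" "real m + 1 < 1 / infdist x F" "1 / infdist x F \<le> real m + 2"
          using c unfolding m_def by linarith+
        have "x \<in> R m" using m(2,3) pos x by (simp add: R_def field_simps)
        then have "x \<in> R ((m - k) + k)" using m(1) by simp
        then show ?thesis by blast
      qed simp
    qed
    then have "?H (A - F) \<le> ?H (B k \<union> (\<Union>j. R (j + k)))" by (rule hausdorff_outer_mono)
    also have "\<dots> \<le> ?H (B k) + ?H (\<Union>j. R (j + k))" by (rule hausdorff_outer_Un)
    also have "\<dots> \<le> ?H (B k) + (\<Sum>j. ?H (R (j + k)))"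
      by (intro add_left_mono hausdorff_outer_subadditive)
    finally have 1: "?H (A - F) \<le> ?H (B k) + (\<Sum>j. ?H (R (j + k)))" .
    have "?H (A \<inter> F) + ?H (B k) \<le> ?H (A \<inter> F \<union> B k)"
    proof (rule hausdorff_outer_separated)
      show "0 < 1 / (real k + 1)" by simp
      fix x y assume "x \<in> A \<inter> F" "y \<in> B k"
      then show "1 / (real k + 1) \<le> dist x y"
        using infdist_le[of x F y] by (auto simp: B_def dist_commute)
    qed
    also have "\<dots> \<le> ?H A" by (rule hausdorff_outer_mono) (auto simp: B_def)
    finally have 2: "?H (A \<inter> F) + ?H (B k) \<le> ?H A" .
    have "?H (A \<inter> F) + ?H (A - F) \<le> ?H (A \<inter> F) + (?H (B k) + (\<Sum>j. ?H (R (j + k))))"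
      using 1 by (rule add_left_mono)
    also have "\<dots> \<le> ?H A + (\<Sum>j. ?H (R (j + k)))"
      using add_right_mono[OF 2] by (simp add: add.assoc)
    finally show ?thesis .
  qed
  have "(\<lambda>k. ?H A + (\<Sum>j. ?H (R (j + k)))) \<longlonglongrightarrow> ?H A + 0"
    by (intro tendsto_add tendsto_const tail)
  then show ?thesis
    using bound by (auto intro: LIMSEQ_le_const)
qed simp

text \<open>An outer measure is a measure on its Caratheodory measurable sets, here
  \<open>?L\<close>. Closed sets belong to \<open>?L\<close> by the splitting lemma, and they
  generate the Borel sets.\<close>

lemma measure_space_hausdorff_outer:
  "measure_space (UNIV :: 'a::metric_space set) (sets borel) (hausdorff_outer s)"
proof -
  let ?L = "lambda_system UNIV (Pow UNIV) (hausdorff_outer s :: 'a set \<Rightarrow> _)"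
  have "outer_measure_space (Pow UNIV) (hausdorff_outer s :: 'a set \<Rightarrow> _)"
    by (auto simp: outer_measure_space_def positive_def increasing_def countably_subadditive_def
        hausdorff_outer_finite_eq_0 intro: hausdorff_outer_mono hausdorff_outer_subadditive)
  then have L: "measure_space UNIV ?L (hausdorff_outer s)"
    by (rule sigma_algebra.caratheodory_lemma[OF sigma_algebra_Pow])
  have "F \<in> ?L" if "closed F" for F :: "'a set"
  proof -
    have "hausdorff_outer s (A \<inter> F) + hausdorff_outer s (A - F) = hausdorff_outer s A" for A
    proof (rule antisym)
      show "hausdorff_outer s (A \<inter> F) + hausdorff_outer s (A - F) \<le> hausdorff_outer s A"
        using hausdorff_outer_closed_split[OF that]
        by (cases "F = {}") (auto simp: hausdorff_outer_finite_eq_0)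
      show "hausdorff_outer s A \<le> hausdorff_outer s (A \<inter> F) + hausdorff_outer s (A - F)"
        using hausdorff_outer_Un[of s "A \<inter> F" "A - F"] by (simp add: Int_Diff_Un)
    qed
    then show ?thesis
      by (simp add: lambda_system_def Int_commute Diff_eq)
  qed
  then have "sigma_sets UNIV (Collect closed) \<subseteq> ?L"
    using L by (intro sigma_algebra.sigma_sets_subset) (auto simp: measure_space_def)
  moreover have "sets borel = sigma_sets UNIV (Collect closed :: 'a set set)"
    by (simp add: borel_eq_closed)
  ultimately have sub: "sets borel \<subseteq> ?L" by simp
  with L show ?thesis
    using sets.sigma_algebra_axioms[of "borel :: 'a measure"]
    by (auto simp: measure_space_def positive_def countably_additive_def subset_iff)
qed

text \<open>\<open>measure_of\<close> yields the given set function only if it is a measure on the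
  generated sigma algebra, and zero otherwise; \<open>measure_space_hausdorff_outer\<close> rules
  out the second case.\<close>

lemma emeasure_hausdorff_measure:
  "A \<in> sets borel \<Longrightarrow> emeasure (hausdorff_measure s) A = hausdorff_outer s A"
  using measure_space_hausdorff_outer[of s] sets.sigma_sets_eq[of borel]
  unfolding hausdorff_measure_def
  by (subst emeasure_measure_of_sigma) (auto simp: measure_space_def)

lemma sets_hausdorff_measure: "sets (hausdorff_measure s) = sets borel"
  unfolding hausdorff_measure_def using sets.sigma_sets_eq[of borel] by simp

lemma space_hausdorff_measure: "space (hausdorff_measure s) = UNIV"
  unfolding hausdorff_measure_def by simp

section \<open>The unit sphere\<close>

lemma powr_DIM_minus_1:
  "0 < x \<Longrightarrow> x powr (real DIM('a::euclidean_space) - 1) = x ^ DIM('a) / x"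
  by (simp add: powr_diff powr_realpow)

definition unit_cone :: "'a::real_vector set \<Rightarrow> 'a set" where
  "unit_cone A = {r *\<^sub>R x | r x. 0 \<le> r \<and> r \<le> 1 \<and> x \<in> A}"

text \<open>About \<open>1 / d\<close> balls of radius \<open>2 * d\<close>, centred along one generator, cover the cone.\<close>
lemma unit_cone_volume_bound:
  fixes E :: "'a::euclidean_space set"
  assumes E: "E \<subseteq> sphere 0 1" "\<And>x y. x \<in> E \<Longrightarrow> y \<in> E \<Longrightarrow> dist x y \<le> d" and d: "0 < d" "d \<le> 1"
  obtains U where "U \<in> sets borel" "unit_cone E \<subseteq> U"
    "emeasure lborel U \<le>
      ennreal (3 / 2 * unit_ball_vol DIM('a) * 4 ^ DIM('a) * (d / 2) powr (real DIM('a) - 1))"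
proof (cases "E = {}")
  case True
  then show ?thesis using that[of "{}"] by (simp add: unit_cone_def)
next
  case False
  then obtain z where z: "z \<in> E" by blast
  \<comment> \<open>The centres are \<open>1 / K \<le> d\<close> apart along the generator through
    \<open>z\<close>, and \<open>K \<le> 2 / d\<close> keeps the number \<open>K + 1\<close> of
    balls at most \<open>3 / d\<close>.\<close>
  define K where "K = nat \<lceil>1 / d\<rceil>"
  have "1 \<le> 1 / d" using d by simp
  then have K: "1 / d \<le> real K" "real K \<le> 2 * (1 / d)" "0 < K"
    unfolding K_def using real_nat_ceiling_ge[of "1 / d"] by linarith+
  define U where "U = (\<Union>k\<le>K. cball ((real k / real K) *\<^sub>R z) (2 * d))"
  have "unit_cone E \<subseteq> U"
  proof
    fix y assume "y \<in> unit_cone E"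
    then obtain r x where y: "y = r *\<^sub>R x" and r: "0 \<le> r" "r \<le> 1" and x: "x \<in> E"
      by (auto simp: unit_cone_def)
    define k where "k = nat \<lfloor>r * real K\<rfloor>"
    have k: "real k \<le> r * real K" "r * real K < real k + 1"
      using r(1) unfolding k_def by (simp_all add: of_nat_nat)
    have "r * real K \<le> 1 * real K" by (intro mult_right_mono r) simp
    then have "k \<le> K" using k(1) by linarith
    have "r - real k / real K = (r * real K - real k) / real K"
      using K(3) by (simp add: field_simps)
    then have "\<bar>r - real k / real K\<bar> \<le> 1 / real K"
      using k by (simp add: divide_right_mono)
    also have "\<dots> \<le> d" using K d by (simp add: field_simps)
    finally have 1: "\<bar>r - real k / real K\<bar> \<le> d" .
    have n: "norm x = 1" "norm z = 1" using x z E(1) by auto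
    \<comment> \<open>One \<open>d\<close> pays for passing from the generator through
      \<open>x\<close> to the one through \<open>z\<close>, the other for the nearest centre below;
      hence the radius \<open>2 * d\<close>.\<close>
    have "y - (real k / real K) *\<^sub>R z = r *\<^sub>R (x - z) + (r - real k / real K) *\<^sub>R z"
      by (simp add: y algebra_simps)
    then have "norm (y - (real k / real K) *\<^sub>R z) \<le> norm (r *\<^sub>R (x - z)) + norm ((r - real k / real K) *\<^sub>R z)"
      by (metis norm_triangle_ineq)
    also have "\<dots> \<le> 1 * d + d"
      using E(2)[OF x z] r 1 n unfolding norm_scaleR
      by (intro add_mono mult_mono) (auto simp: dist_norm)
    finally have "y \<in> cball ((real k / real K) *\<^sub>R z) (2 * d)"
      by (simp add: dist_norm norm_minus_commute)
    then show "y \<in> U" using \<open>k \<le> K\<close> by (auto simp: U_def)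
  qed
  moreover have "U \<in> sets borel" by (auto simp: U_def)
  moreover have "emeasure lborel U \<le>
      ennreal (3 / 2 * unit_ball_vol DIM('a) * 4 ^ DIM('a) * (d / 2) powr (real DIM('a) - 1))"
  proof -
    have "emeasure lborel U \<le> (\<Sum>k\<le>K. emeasure lborel (cball ((real k / real K) *\<^sub>R z) (2 * d)))"
      unfolding U_def by (intro emeasure_subadditive_finite) auto
    also have "\<dots> = ennreal ((real K + 1) * (unit_ball_vol DIM('a) * (2 * d) ^ DIM('a)))"
      using d by (simp add: emeasure_cball ennreal_of_nat_eq_real_of_nat flip: ennreal_mult)
        (simp flip: ennreal_plus ennreal_1 ennreal_mult add: ennreal_of_nat_eq_real_of_nat)
    also have "\<dots> \<le> ennreal (3 / d * (unit_ball_vol DIM('a) * (2 * d) ^ DIM('a)))"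
    proof (intro ennreal_leI mult_right_mono)
      have "real K + 1 \<le> 3 * (1 / d)" using K \<open>1 \<le> 1 / d\<close> by linarith
      then show "real K + 1 \<le> 3 / d" by simp
    qed (use d in auto)
    \<comment> \<open>Expressed through \<open>d / 2\<close>, as in
      \<open>hausdorff_weight\<close>.\<close>
    also have "3 / d * (unit_ball_vol DIM('a) * (2 * d) ^ DIM('a)) =
      3 / 2 * unit_ball_vol DIM('a) * 4 ^ DIM('a) * (d / 2) powr (real DIM('a) - 1)"
    proof -
      have "(2 * d) ^ DIM('a) = 4 ^ DIM('a) * (d / 2) ^ DIM('a)"
        using power_mult_distrib[of 4 "d / 2" "DIM('a)"] by simp
      then show ?thesis using d by (simp add: powr_DIM_minus_1)
    qed
    finally show ?thesis .
  qed
  ultimately show ?thesis using that by blast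
qed

text \<open>The cone over a set of small diameter has volume at most a constant times the weight of
  that set, and the cones over a cover of \<open>A\<close> cover the cone over \<open>A\<close>.
  Using a Borel set \<open>S\<close> inside the cone avoids the measurability of the cone over an
  arbitrary \<open>A\<close>.\<close>

lemma hausdorff_outer_ge_cone_volume:
  assumes "2 \<le> DIM('a::euclidean_space)"
  obtains c where "0 < c"
    "\<And>A S :: 'a set. A \<subseteq> sphere 0 1 \<Longrightarrow> S \<in> sets borel \<Longrightarrow> S \<subseteq> unit_cone A \<Longrightarrow>
      ennreal c * emeasure lborel S \<le> hausdorff_outer (real DIM('a) - 1) A"
proof -
  define s where "s = real DIM('a) - 1"
  have s: "0 < s" using assms by (simp add: s_def)
  define C where "C = 3 / 2 * unit_ball_vol DIM('a) * 4 ^ DIM('a)"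
  \<comment> \<open>This factor turns the cone bound \<open>C * (t / 2) powr s\<close> into the
    weight of a set of diameter \<open>t\<close>.\<close>
  define c where "c = unit_ball_vol s / C"
  have C: "0 < C" by (simp add: C_def)
  have c: "0 < c" using s C by (simp add: c_def)
  have "ennreal c * emeasure lborel S \<le> hausdorff_outer s A"
    if A: "A \<subseteq> sphere 0 1" and S: "S \<in> sets borel" "S \<subseteq> unit_cone A" for A S :: "'a set"
  proof -
    \<comment> \<open>Scale \<open>1 / 2\<close> leaves room for enlarging each diameter slightly
      while staying in the range up to 1 of the cone bound.\<close>
    have "ennreal c * emeasure lborel S \<le> hausdorff_content s (1 / 2) A"
      unfolding hausdorff_content_def
    proof (rule INF_greatest, clarify)
      fix E :: "nat \<Rightarrow> 'a set"
      assume cov: "A \<subseteq> (\<Union>i. E i)" and E: "\<forall>i. bounded (E i) \<and> diameter (E i) \<le> 1 / 2"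
      show "ennreal c * emeasure lborel S \<le> (\<Sum>i. hausdorff_weight s (E i))"
      proof (rule ennreal_le_epsilon)
        fix e :: real
        assume e: "0 < e"
        have "\<exists>U. U \<in> sets borel \<and> unit_cone (E i \<inter> A) \<subseteq> U \<and>
          ennreal c * emeasure lborel U \<le> hausdorff_weight s (E i) + ennreal (e * (1/2) ^ Suc i)" for i
        proof -
          let ?d = "diameter (E i)" and ?f = "\<lambda>t. unit_ball_vol s * (t / 2) powr s"
          have d: "0 \<le> ?d" "?d \<le> 1 / 2" using E by (auto simp: diameter_ge_0)
          \<comment> \<open>The cone bound wants a positive diameter, but \<open>E i\<close> may
            have diameter 0. Continuity from the right provides a slightly larger \<open>t\<close>
            at a cost below \<open>e * (1/2) ^ Suc i\<close>.\<close>
          have "(?f \<longlongrightarrow> ?f ?d) (at_right ?d)"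
            using s d by (intro tendsto_intros tendsto_powr') (auto simp: eventually_at_filter)
          then have "eventually (\<lambda>t. ?f t < ?f ?d + e * (1/2) ^ Suc i) (at_right ?d)"
            using e by (intro order_tendstoD) auto
          moreover have "eventually (\<lambda>t. ?d < t \<and> t < 1) (at_right ?d)"
            using d eventually_at_right_real[of ?d 1] by auto
          ultimately obtain t where t: "?f t < ?f ?d + e * (1/2) ^ Suc i" "?d < t" "t < 1"
            using eventually_happens'[OF trivial_limit_at_right_real eventually_conj] by blast
          obtain U where U: "U \<in> sets borel" "unit_cone (E i \<inter> A) \<subseteq> U"
            "emeasure lborel U \<le> ennreal (C * (t / 2) powr s)"
          proof (rule unit_cone_volume_bound[of "E i \<inter> A" t])
            show "dist x y \<le> t" if "x \<in> E i \<inter> A" "y \<in> E i \<inter> A" for x y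
              using diameter_bounded_bound[of "E i" x y] that E t by auto
          qed (use A d t in \<open>auto simp: C_def s_def\<close>)
          have "ennreal c * emeasure lborel U \<le> ennreal c * ennreal (C * (t / 2) powr s)"
            by (intro mult_left_mono U) simp
          also have "\<dots> = ennreal (?f t)"
            using c C by (simp add: c_def flip: ennreal_mult)
          also have "\<dots> \<le> ennreal (?f ?d + e * (1/2) ^ Suc i)"
            using t by (intro ennreal_leI) auto
          also have "\<dots> = hausdorff_weight s (E i) + ennreal (e * (1/2) ^ Suc i)"
            using e s by (intro ennreal_plus) auto
          finally show ?thesis using U by blast
        qed
        then obtain U where U: "\<And>i. U i \<in> sets borel" "\<And>i. unit_cone (E i \<inter> A) \<subseteq> U i"
          "\<And>i. ennreal c * emeasure lborel (U i) \<le> hausdorff_weight s (E i) + ennreal (e * (1/2) ^ Suc i)"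
          by metis
        have "S \<subseteq> (\<Union>i. U i)"
        proof
          fix y assume "y \<in> S"
          then obtain r x where "y = r *\<^sub>R x" "0 \<le> r" "r \<le> 1" "x \<in> A"
            using S by (auto simp: unit_cone_def)
          moreover obtain i where "x \<in> E i" using cov calculation by blast
          ultimately have "y \<in> unit_cone (E i \<inter> A)" by (auto simp: unit_cone_def)
          then show "y \<in> (\<Union>i. U i)" using U(2) by blast
        qed
        then have "emeasure lborel S \<le> emeasure lborel (\<Union>i. U i)"
          using U(1) by (intro emeasure_mono) auto
        also have "\<dots> \<le> (\<Sum>i. emeasure lborel (U i))"
          using U(1) by (intro emeasure_subadditive_countably) auto
        finally have "ennreal c * emeasure lborel S \<le> (\<Sum>i. ennreal c * emeasure lborel (U i))"
          by (simp add: mult_left_mono)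
        also have "\<dots> \<le> (\<Sum>i. hausdorff_weight s (E i) + ennreal (e * (1/2) ^ Suc i))"
          using U(3) by (intro suminf_le) auto
        also have "\<dots> = (\<Sum>i. hausdorff_weight s (E i)) + (\<Sum>i. ennreal (e * (1/2) ^ Suc i))"
          by (intro suminf_add[symmetric]) auto
        also have "(\<Sum>i. ennreal (e * (1/2) ^ Suc i)) = ennreal e"
          using sums_mult[OF power_half_series, of e] e
          by (subst suminf_ennreal_eq) auto
        finally show "ennreal c * emeasure lborel S \<le> (\<Sum>i. hausdorff_weight s (E i)) + ennreal e" .
      qed
    qed
    also have "\<dots> \<le> hausdorff_outer s A" by (rule hausdorff_content_le_outer) simp
    finally show ?thesis .
  qed
  then show ?thesis using that c unfolding s_def by blast
qed

text \<open>At most \<open>3 / a\<close> translates of the slab along \<open>w\<close> cover a fixed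
  ball of radius \<open>1 / 10\<close>, so the volume of the slab is at least of order
  \<open>a\<close>.\<close>

lemma slab_volume_ge:
  fixes w :: "'a::euclidean_space"
  assumes "2 \<le> DIM('a)" "norm w = 1" "0 < a" "a \<le> 1"
  shows "unit_ball_vol DIM('a) * (1 / 10) ^ DIM('a) * a / 3
    \<le> measure lebesgue {x. 1 / 2 \<le> norm x \<and> norm x \<le> 1 \<and> \<bar>x \<bullet> w\<bar> \<le> a / 2}"
proof -
  define S where "S = {x::'a. 1 / 2 \<le> norm x \<and> norm x \<le> 1 \<and> \<bar>x \<bullet> w\<bar> \<le> a / 2}"
  have "closed S" unfolding S_def
    by (intro closed_Collect_conj closed_Collect_le continuous_intros)
  moreover have "bounded S" by (auto simp: S_def bounded_iff)
  ultimately have "compact S" by (simp add: compact_eq_bounded_closed)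
  obtain p0 where p0: "p0 \<noteq> 0" "orthogonal w p0"
    using orthogonal_to_vector_exists[OF assms(1)] by blast
  \<comment> \<open>The ball is centred orthogonally to \<open>w\<close> at distance
    \<open>7 / 10\<close>: its points have norm between \<open>6 / 10\<close> and
    \<open>8 / 10\<close> and height below \<open>1 / 10\<close>, which leaves room for the shift
    along \<open>w\<close>.\<close>
  define p where "p = (7 / 10 / norm p0) *\<^sub>R p0"
  have p: "norm p = 7 / 10" "p \<bullet> w = 0"
    using p0 by (auto simp: p_def orthogonal_def inner_commute)
  define J where "J = \<lfloor>1 / a\<rfloor>"
  have a1: "1 \<le> 1 / a" using assms by simp
  have J: "1 \<le> J" "real_of_int J \<le> 1 / a" using a1 by (auto simp: J_def)
  have "ball p (1 / 10) \<subseteq> (\<Union>j\<in>{-J..J}. (+) ((of_int j * a) *\<^sub>R w) ` S)"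
  proof
    fix x assume "x \<in> ball p (1 / 10)"
    then have x: "norm (x - p) < 1 / 10" by (simp add: dist_norm norm_minus_commute)
    have "\<bar>x \<bullet> w\<bar> = \<bar>(x - p) \<bullet> w\<bar>" using p by (simp add: inner_diff_left)
    also have "\<dots> \<le> norm (x - p)"
      using Cauchy_Schwarz_ineq2[of "x - p" w] assms by simp
    finally have xw: "\<bar>x \<bullet> w\<bar> < 1 / 10" using x by simp
    have nx: "6 / 10 < norm x" "norm x < 8 / 10"
      using x p norm_triangle_ineq2[of p x] norm_triangle_ineq2[of x p]
      by (auto simp: norm_minus_commute)
    \<comment> \<open>Rounding to the nearest multiple of \<open>a\<close> brings the height of
      \<open>x\<close> over the hyperplane into the range of \<open>S\<close>.\<close>
    define j where "j = round (x \<bullet> w / a)"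
    have rd: "\<bar>of_int j - x \<bullet> w / a\<bar> \<le> 1 / 2" unfolding j_def by (rule of_int_round_abs_le)
    define z where "z = x - (of_int j * a) *\<^sub>R w"
    have zw: "z \<bullet> w = x \<bullet> w - of_int j * a"
      using assms by (simp add: z_def inner_diff_left norm_eq_1)
    have "\<bar>z \<bullet> w\<bar> = a * \<bar>of_int j - x \<bullet> w / a\<bar>"
    proof -
      have "z \<bullet> w = - (a * (of_int j - x \<bullet> w / a))" using assms by (simp add: zw algebra_simps)
      then show ?thesis using assms by (simp add: abs_mult)
    qed
    also have "\<dots> \<le> a * (1 / 2)" using rd assms by (intro mult_left_mono) auto
    finally have zw2: "\<bar>z \<bullet> w\<bar> \<le> a / 2" by simp
    \<comment> \<open>Only the component along \<open>w\<close> changes, so by Pythagoras the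
      squared norm of \<open>z\<close> lies between \<open>0.36 - 0.01\<close> and
      \<open>0.64 + 0.25\<close>, hence between \<open>1 / 4\<close> and 1.\<close>
    have "(norm z)\<^sup>2 = (norm x)\<^sup>2 - (x \<bullet> w)\<^sup>2 + (z \<bullet> w)\<^sup>2"
      unfolding zw power2_norm_eq_inner z_def using assms
      by (simp add: inner_diff_left inner_diff_right norm_eq_1 inner_commute power2_eq_square algebra_simps)
    moreover have "(x \<bullet> w)\<^sup>2 \<le> (1/10)\<^sup>2" "(z \<bullet> w)\<^sup>2 \<le> (1/2)\<^sup>2"
      using xw zw2 assms by (auto intro!: abs_le_square_iff[THEN iffD1])
    moreover have "(6/10)\<^sup>2 \<le> (norm x)\<^sup>2" "(norm x)\<^sup>2 \<le> (8/10)\<^sup>2"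
      using nx by (auto intro!: power_mono)
    moreover have "0 \<le> (z \<bullet> w)\<^sup>2" "0 \<le> (x \<bullet> w)\<^sup>2" by simp_all
    ultimately have "(1/2)\<^sup>2 \<le> (norm z)\<^sup>2" "(norm z)\<^sup>2 \<le> 1\<^sup>2"
      unfolding power2_eq_square by linarith+
    then have "1/2 \<le> norm z" "norm z \<le> 1"
      by (auto intro: power2_le_imp_le)
    then have "z \<in> S" using zw2 by (simp add: S_def)
    have "\<bar>x \<bullet> w / a\<bar> \<le> 1 / 10 * (1 / a)"
      using xw assms by (simp add: divide_simps)
    then have "\<bar>of_int j\<bar> \<le> 1 / a" using rd a1 by linarith
    then have "j \<in> {-J..J}" unfolding J_def by (auto simp: le_floor_iff minus_le_iff abs_le_iff)
    moreover have "x = (of_int j * a) *\<^sub>R w + z" by (simp add: z_def)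
    ultimately show "x \<in> (\<Union>j\<in>{-J..J}. (+) ((of_int j * a) *\<^sub>R w) ` S)" using \<open>z \<in> S\<close> by blast
  qed
  moreover have T: "(+) v ` S \<in> lmeasurable" for v
    using \<open>compact S\<close> by (intro lmeasurable_compact compact_translation)
  ultimately have "measure lebesgue (ball p (1 / 10)) \<le> measure lebesgue (\<Union>j\<in>{-J..J}. (+) ((of_int j * a) *\<^sub>R w) ` S)"
    by (intro measure_mono_fmeasurable fmeasurable.finite_UN) auto
  also have "\<dots> \<le> (\<Sum>j\<in>{-J..J}. measure lebesgue ((+) ((of_int j * a) *\<^sub>R w) ` S))"
    by (intro measure_UNION_le) (auto simp: fmeasurableD[OF T])
  also have "\<dots> = (2 * real_of_int J + 1) * measure lebesgue S"
    using J by (simp add: measure_translation)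
  also have "\<dots> \<le> 3 / a * measure lebesgue S"
    using J a1 by (intro mult_right_mono) auto
  finally have "unit_ball_vol DIM('a) * (1 / 10) ^ DIM('a) \<le> 3 / a * measure lebesgue S"
    by (simp add: content_ball)
  then show ?thesis using assms by (simp add: S_def field_simps)
qed

text \<open>Radial projection at most doubles the height of a point of norm at least
  \<open>1 / 2\<close>, so the slab of height \<open>a / 2\<close> lies in the cone over the band of
  height \<open>a\<close>.\<close>

lemma hausdorff_outer_band_ge:
  assumes "2 \<le> DIM('a::euclidean_space)"
  obtains c where "0 < c" "\<And>(w::'a) a. norm w = 1 \<Longrightarrow> 0 < a \<Longrightarrow> a \<le> 1 \<Longrightarrow>
    ennreal (c * a) \<le> hausdorff_outer (real DIM('a) - 1) {x \<in> sphere 0 1. \<bar>x \<bullet> w\<bar> \<le> a}"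
proof -
  obtain c where c: "0 < c" and
    le: "\<And>A S :: 'a set. A \<subseteq> sphere 0 1 \<Longrightarrow> S \<in> sets borel \<Longrightarrow> S \<subseteq> unit_cone A \<Longrightarrow>
      ennreal c * emeasure lborel S \<le> hausdorff_outer (real DIM('a) - 1) A"
    using hausdorff_outer_ge_cone_volume[OF assms] by blast
  define V where "V = unit_ball_vol DIM('a) * (1 / 10) ^ DIM('a) / 3"
  have "ennreal (c * V * a) \<le> hausdorff_outer (real DIM('a) - 1) {x \<in> sphere 0 1. \<bar>x \<bullet> w\<bar> \<le> a}"
    if w: "norm w = 1" and a: "0 < a" "a \<le> 1" for w :: 'a and a
  proof -
    define S where "S = {x::'a. 1 / 2 \<le> norm x \<and> norm x \<le> 1 \<and> \<bar>x \<bullet> w\<bar> \<le> a / 2}"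
    have "closed S" unfolding S_def
      by (intro closed_Collect_conj closed_Collect_le continuous_intros)
    moreover have "bounded S" by (auto simp: S_def bounded_iff)
    ultimately have S: "compact S" by (simp add: compact_eq_bounded_closed)
    have "S \<subseteq> unit_cone {x \<in> sphere 0 1. \<bar>x \<bullet> w\<bar> \<le> a}"
    proof
      fix x assume x: "x \<in> S"
      then have n: "1 / 2 \<le> norm x" "norm x \<le> 1" "\<bar>x \<bullet> w\<bar> \<le> a / 2" by (auto simp: S_def)
      have "a * (1 / 2) \<le> a * norm x" using n a by (intro mult_left_mono) auto
      then have "\<bar>x \<bullet> w\<bar> \<le> a * norm x" using n by linarith
      then have "inverse (norm x) * \<bar>x \<bullet> w\<bar> \<le> inverse (norm x) * (a * norm x)"
        by (intro mult_left_mono) auto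
      moreover have "norm x \<noteq> 0" using n by linarith
      moreover have "inverse (norm x) * (a * norm x) = a"
        using \<open>norm x \<noteq> 0\<close> by simp
      ultimately have "\<bar>(x /\<^sub>R norm x) \<bullet> w\<bar> \<le> a"
        by (simp add: abs_mult)
      moreover have "x = norm x *\<^sub>R (x /\<^sub>R norm x)" "x /\<^sub>R norm x \<in> sphere 0 1"
        using n by (auto simp: divide_simps)
      ultimately show "x \<in> unit_cone {x \<in> sphere 0 1. \<bar>x \<bullet> w\<bar> \<le> a}"
        using n unfolding unit_cone_def by (intro CollectI exI[of _ "norm x"] exI[of _ "x /\<^sub>R norm x"]) auto
    qed
    then have 1: "ennreal c * emeasure lborel S \<le> hausdorff_outer (real DIM('a) - 1) {x \<in> sphere 0 1. \<bar>x \<bullet> w\<bar> \<le> a}"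
      using S by (intro le) (auto simp: borel_compact)
    have "V * a \<le> measure lebesgue S"
      using slab_volume_ge[OF assms w a] by (simp add: S_def V_def)
    then have "ennreal (V * a) \<le> emeasure lborel S"
      using emeasure_compact_finite[OF S] borel_compact[OF S]
      by (simp add: emeasure_eq_ennreal_measure ennreal_leI less_top)
    then have "ennreal c * ennreal (V * a) \<le> ennreal c * emeasure lborel S"
      by (intro mult_left_mono) auto
    then show ?thesis
      using 1 c a by (simp add: V_def mult.assoc flip: ennreal_mult)
  qed
  moreover have "0 < c * V" using c by (simp add: V_def)
  ultimately show ?thesis using that by blast
qed

section \<open>Upper bound: the sphere has finite measure, by packing\<close>

text \<open>The right side is the chord over the unit interval of a convex function. Together with
  Bernoulli's inequality it makes the volume of a shell linear in its thickness.\<close>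

lemma one_plus_power_le:
  fixes x :: real
  assumes "0 \<le> x" "x \<le> 1"
  shows "(1 + x) ^ n \<le> 1 + x * (2 ^ n - 1)"
proof (induction n)
  case (Suc n)
  have "(1 + x) ^ Suc n \<le> (1 + x) * (1 + x * (2 ^ n - 1))"
    using Suc assms by (simp add: mult_left_mono)
  also have "\<dots> \<le> 1 + x * (2 ^ Suc n - 1)"
    using mult_right_mono[OF assms(2), of "x * (2 ^ n - 1)"] assms(1) one_le_power[of "2::real" n]
    by (simp add: algebra_simps mult_le_cancel_left1)
  finally show ?case .
qed simp

text \<open>Balls of radius \<open>d / 2\<close> around the points of \<open>F\<close> are disjoint
  and fit between the spheres of radii \<open>1 - d / 2\<close> and \<open>1 + d / 2\<close>.
  Adjoining the inner ball as one more disjoint piece compares their total volume with that of the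
  shell, which is of order \<open>d\<close>.\<close>

lemma separated_in_sphere_card_le:
  fixes F :: "'a::euclidean_space set"
  assumes F: "finite F" "F \<subseteq> sphere 0 1" and d: "0 < d" "d \<le> 1"
    and sep: "\<And>x y. x \<in> F \<Longrightarrow> y \<in> F \<Longrightarrow> x \<noteq> y \<Longrightarrow> d \<le> dist x y"
  shows "real (card F) * (d / 2) ^ DIM('a) \<le> d / 2 * (2 ^ DIM('a) + real DIM('a))"
proof -
  let ?n = "DIM('a)" and ?w = "unit_ball_vol DIM('a)"
  have sub: "(\<Union>x\<in>F. ball x (d / 2)) \<union> cball 0 (1 - d / 2) \<subseteq> cball 0 (1 + d / 2)"
  proof -
    have "norm y \<le> 1 + d / 2" if "x \<in> F" "dist x y < d / 2" for x y
      using that F norm_triangle_ineq2[of y x] by (auto simp: dist_norm norm_minus_commute)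
    then show ?thesis using d by auto
  qed
  have disj: "(\<Union>x\<in>F. ball x (d / 2)) \<inter> cball 0 (1 - d / 2) = {}"
  proof -
    have "1 - d / 2 < norm y" if "x \<in> F" "dist x y < d / 2" for x y
      using that F norm_triangle_ineq2[of x y] by (auto simp: dist_norm norm_minus_commute)
    then show ?thesis by (fastforce simp: not_le)
  qed
  have df: "disjoint_family_on (\<lambda>x. ball x (d / 2)) F"
  proof (clarsimp simp: disjoint_family_on_def disjoint_iff)
    fix x y z assume "x \<in> F" "y \<in> F" "x \<noteq> y" "dist x z * 2 < d" "dist y z * 2 < d"
    then show False using sep[of x y] dist_triangle2[of x y z] by linarith
  qed
  have "real (card F) * (?w * (d / 2) ^ ?n) = (\<Sum>x\<in>F. measure lborel (ball x (d / 2)))"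
    using d by (simp add: content_ball)
  also have "\<dots> = measure lborel (\<Union>x\<in>F. ball x (d / 2))"
    using F(1) df by (intro measure_finite_Union[symmetric]) (use d in \<open>auto simp: emeasure_ball\<close>)
  finally have "real (card F) * (?w * (d / 2) ^ ?n) + ?w * (1 - d / 2) ^ ?n =
      measure lborel (\<Union>x\<in>F. ball x (d / 2)) + measure lborel (cball (0::'a) (1 - d / 2))"
    using d by (simp add: content_cball)
  also have "\<dots> = measure lborel ((\<Union>x\<in>F. ball x (d / 2)) \<union> cball 0 (1 - d / 2))"
  proof (intro measure_Union[symmetric] disj)
    have "emeasure lborel (\<Union>x\<in>F. ball x (d / 2)) \<le> emeasure lborel (cball (0::'a) (1 + d / 2))"
      using sub by (intro emeasure_mono) auto
    then show "emeasure lborel (\<Union>x\<in>F. ball x (d / 2)) \<noteq> \<infinity>"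
      using d by (auto simp: emeasure_cball top_unique)
  qed (use d F(1) in \<open>auto simp: emeasure_cball intro!: sets.finite_UN\<close>)
  also have "\<dots> \<le> measure lborel (cball (0::'a) (1 + d / 2))"
    using sub d F(1) by (intro measure_mono_fmeasurable sets.Un sets.finite_UN)
      (auto simp: fmeasurable_def emeasure_cball less_top)
  also have "\<dots> = ?w * (1 + d / 2) ^ ?n"
    using d by (simp add: content_cball)
  finally have "?w * (real (card F) * (d / 2) ^ ?n) \<le> ?w * ((1 + d / 2) ^ ?n - (1 - d / 2) ^ ?n)"
    by (simp add: algebra_simps)
  then have "real (card F) * (d / 2) ^ ?n \<le> (1 + d / 2) ^ ?n - (1 - d / 2) ^ ?n"
    by (simp add: mult_le_cancel_left_pos)
  also have "\<dots> \<le> (1 + d / 2 * (2 ^ ?n - 1)) - (1 + real ?n * (- (d / 2)))"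
    using d Bernoulli_inequality[of "- (d / 2)" ?n]
    by (intro diff_mono one_plus_power_le) auto
  also have "\<dots> \<le> d / 2 * (2 ^ ?n + real ?n)"
    using d by (simp add: algebra_simps)
  finally show ?thesis .
qed

text \<open>A \<open>d\<close>-separated set of largest cardinality is also a \<open>d\<close>-net,
  since an uncovered point could be added to it. The packing bound on its cardinality cancels the
  weight of the balls, leaving a bound independent of \<open>d\<close>.\<close>

lemma hausdorff_content_sphere_le:
  assumes d: "0 < d" "d \<le> 1" and dim: "1 \<le> DIM('a::euclidean_space)"
  shows "hausdorff_content (real DIM('a) - 1) (2 * d) (sphere (0::'a) 1)
    \<le> ennreal (unit_ball_vol (real DIM('a) - 1) * 2 ^ DIM('a) * (2 ^ DIM('a) + real DIM('a)))"
proof -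
  let ?n = "DIM('a)" and ?s = "real DIM('a) - 1"
  define P where "P = (\<lambda>F::'a set. finite F \<and> F \<subseteq> sphere 0 1 \<and>
    (\<forall>x\<in>F. \<forall>y\<in>F. x \<noteq> y \<longrightarrow> d \<le> dist x y))"
  have bd: "real (card F) * (d / 2) ^ ?n \<le> d / 2 * (2 ^ ?n + real ?n)" if "P F" for F
    using that separated_in_sphere_card_le[of F d] d by (auto simp: P_def)
  let ?b = "d / 2 * (2 ^ ?n + real ?n) / (d / 2) ^ ?n"
  have "\<exists>F. P F \<and> (\<forall>F'. P F' \<longrightarrow> card F' \<le> card F)"
  proof (rule ex_has_greatest_nat)
    show "P {}" by (simp add: P_def)
    have "card F < Suc (nat \<lceil>?b\<rceil>)" if "P F" for F
    proof -
      have "real (card F) \<le> ?b" using bd[OF that] d by (simp add: field_simps)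
      then show ?thesis by linarith
    qed
    then show "\<forall>F. P F \<longrightarrow> card F < Suc (nat \<lceil>?b\<rceil>)" by blast
  qed
  then obtain F where F: "P F" "\<And>F'. P F' \<Longrightarrow> card F' \<le> card F" by blast
  have cover: "\<exists>y\<in>F. dist y x \<le> d" if "x \<in> sphere 0 1" for x
  proof (rule ccontr)
    assume *: "\<not> ?thesis"
    then have "x \<notin> F" using d by force
    moreover have "P (insert x F)"
      using F(1) * that by (auto simp: P_def dist_commute not_le intro: less_imp_le)
    ultimately show False using F(2)[of "insert x F"] F(1) by (auto simp: P_def)
  qed
  have "finite F" using F by (simp add: P_def)
  then obtain h where h: "bij_betw h {0..<card F} F" using ex_bij_betw_nat_finite by blast
  define E where "E = (\<lambda>i. if i < card F then cball (h i) d else {})"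
  have "sphere 0 1 \<subseteq> (\<Union>i. E i)"
  proof
    fix x :: 'a assume "x \<in> sphere 0 1"
    then obtain y where y: "y \<in> F" "dist y x \<le> d" using cover by blast
    then have "y \<in> h ` {0..<card F}" using h by (simp add: bij_betw_def)
    then obtain i where "i < card F" "y = h i" by auto
    then have "x \<in> E i" using y by (simp add: E_def)
    then show "x \<in> (\<Union>i. E i)" by blast
  qed
  then have "hausdorff_content ?s (2 * d) (sphere (0::'a) 1) \<le> (\<Sum>i. hausdorff_weight ?s (E i))"
    using d by (intro hausdorff_content_le) (auto simp: E_def diameter_cball)
  also have "\<dots> = (\<Sum>i<card F. hausdorff_weight ?s (E i))"
    by (intro suminf_finite) (auto simp: E_def)
  also have "\<dots> = (\<Sum>i<card F. ennreal (unit_ball_vol ?s * d powr ?s))"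
    using d by (intro sum.cong) (auto simp: E_def diameter_cball)
  also have "\<dots> = ennreal (unit_ball_vol ?s * (real (card F) * d powr ?s))"
    using dim by (simp add: ennreal_of_nat_eq_real_of_nat mult_ac flip: ennreal_mult)
  also have "\<dots> \<le> ennreal (unit_ball_vol ?s * 2 ^ ?n * (2 ^ ?n + real ?n))"
  proof (intro ennreal_leI)
    have "d powr ?s = 2 ^ ?n * (d / 2) ^ ?n / d"
      using d power_mult_distrib[of 2 "d / 2" ?n] by (simp add: powr_DIM_minus_1)
    then have "real (card F) * d powr ?s = 2 ^ ?n * (real (card F) * (d / 2) ^ ?n) / d" by simp
    also have "\<dots> \<le> 2 ^ ?n * (d / 2 * (2 ^ ?n + real ?n)) / d"
      using bd[OF F(1)] d by (intro divide_right_mono mult_left_mono) auto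
    also have "\<dots> \<le> 2 ^ ?n * (2 ^ ?n + real ?n)" using d by simp
    finally show "unit_ball_vol ?s * (real (card F) * d powr ?s) \<le> unit_ball_vol ?s * 2 ^ ?n * (2 ^ ?n + real ?n)"
      using dim by (simp add: mult_left_mono mult.assoc)
  qed
  finally show ?thesis .
qed

lemma hausdorff_outer_sphere_finite:
  "hausdorff_outer (real DIM('a) - 1) (sphere (0::'a::euclidean_space) 1) < \<infinity>"
proof -
  have dim: "1 \<le> DIM('a)" using DIM_positive[where 'a = 'a] by simp
  have "hausdorff_outer (real DIM('a) - 1) (sphere (0::'a) 1)
    \<le> ennreal (unit_ball_vol (real DIM('a) - 1) * 2 ^ DIM('a) * (2 ^ DIM('a) + real DIM('a)))"
    unfolding hausdorff_outer_def
  proof (rule SUP_least)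
    fix \<delta> :: real assume "\<delta> \<in> {0<..}"
    \<comment> \<open>The radius \<open>min 1 (\<delta> / 2)\<close> is in the range of the packing
      bound, and twice it is at most the scale \<open>\<delta>\<close>.\<close>
    then have "0 < min 1 (\<delta> / 2)" "2 * min 1 (\<delta> / 2) \<le> \<delta>" by auto
    then show "hausdorff_content (real DIM('a) - 1) \<delta> (sphere (0::'a) 1)
      \<le> ennreal (unit_ball_vol (real DIM('a) - 1) * 2 ^ DIM('a) * (2 ^ DIM('a) + real DIM('a)))"
      using hausdorff_content_sphere_le[of "min 1 (\<delta> / 2)", OF _ _ dim]
      by (auto intro: order_trans[OF hausdorff_content_antimono])
  qed
  then show ?thesis by (auto simp: less_top[symmetric] top_unique)
qed

section \<open>The spherical measure\<close>

lemma space_spherical_measure: "space (spherical_measure :: (real ^ 'n) measure) = sphere 0 1"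
  by (simp add: spherical_measure_def space_restrict_space space_hausdorff_measure)

lemma sets_spherical_measure:
  "sets (spherical_measure :: (real ^ 'n) measure) = sets (restrict_space borel (sphere 0 1))"
  by (simp add: spherical_measure_def sets_restrict_space sets_hausdorff_measure)

lemma closed_in_sets_spherical_measure:
  "closed A \<Longrightarrow> A \<subseteq> sphere 0 1 \<Longrightarrow> A \<in> sets (spherical_measure :: (real ^ 'n) measure)"
  by (simp add: sets_spherical_measure sets_restrict_space_iff)

lemma emeasure_spherical_measure:
  fixes A :: "(real ^ 'n) set"
  assumes "closed A" "A \<subseteq> sphere 0 1"
  shows "emeasure spherical_measure A = hausdorff_outer (real CARD('n) - 1) A"
  using assms unfolding spherical_measure_def
  by (subst emeasure_restrict_space)
    (auto simp: sets_hausdorff_measure space_hausdorff_measure emeasure_hausdorff_measure)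

lemma borel_measurable_spherical_measure:
  fixes f :: "real ^ 'n \<Rightarrow> real"
  assumes "continuous_on (sphere 0 1) f"
  shows "f \<in> borel_measurable spherical_measure"
  using borel_measurable_continuous_on_restrict[OF assms]
  by (simp add: measurable_cong_sets[OF sets_spherical_measure refl])

lemma finite_measure_spherical_measure: "finite_measure (spherical_measure :: (real ^ 'n) measure)"
proof
  have "hausdorff_outer (real CARD('n) - 1) (sphere (0::real ^ 'n) 1) < \<infinity>"
    using hausdorff_outer_sphere_finite[where 'a = "real ^ 'n"] by simp
  then show "emeasure spherical_measure (space (spherical_measure :: (real ^ 'n) measure)) \<noteq> \<infinity>"
    by (simp add: space_spherical_measure emeasure_spherical_measure)
qed

text \<open>Used to discard the two poles \<open>w\<close> and \<open>- w\<close>, at which the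
  spindles around the axis through \<open>w\<close> do not shrink.\<close>

lemma spherical_measure_finite_null:
  fixes A :: "(real ^ 'n) set"
  assumes "finite A" "A \<subseteq> sphere 0 1"
  shows "A \<in> null_sets spherical_measure"
  using assms
  by (intro null_setsI)
    (auto simp: emeasure_spherical_measure closed_in_sets_spherical_measure finite_imp_closed
      hausdorff_outer_finite_eq_0)

lemma spherical_measure_band_ge:
  assumes "2 \<le> CARD('n)"
  obtains c where "0 < c" "\<And>(w::real ^ 'n) a. norm w = 1 \<Longrightarrow> 0 < a \<Longrightarrow> a \<le> 1 \<Longrightarrow>
    ennreal (c * a) \<le> emeasure spherical_measure {x \<in> sphere 0 1. \<bar>x \<bullet> w\<bar> \<le> a}"
proof -
  have closed: "closed {x \<in> sphere 0 1. \<bar>x \<bullet> w\<bar> \<le> a}" for w :: "real ^ 'n" and a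
    unfolding Collect_conj_eq Collect_mem_eq
    by (intro closed_Int closed_sphere closed_Collect_le continuous_intros)
  have "2 \<le> DIM(real ^ 'n)" using assms by simp
  then obtain c where c: "0 < c" "\<And>(w::real ^ 'n) a. norm w = 1 \<Longrightarrow> 0 < a \<Longrightarrow> a \<le> 1 \<Longrightarrow>
    ennreal (c * a) \<le> hausdorff_outer (real DIM(real ^ 'n) - 1) {x \<in> sphere 0 1. \<bar>x \<bullet> w\<bar> \<le> a}"
    using hausdorff_outer_band_ge[where 'a = "real ^ 'n"] by blast
  show ?thesis
  proof (rule that[OF c(1)])
    fix w :: "real ^ 'n" and a :: real
    assume "norm w = 1" "0 < a" "a \<le> 1"
    then show "ennreal (c * a) \<le> emeasure spherical_measure {x \<in> sphere 0 1. \<bar>x \<bullet> w\<bar> \<le> a}"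
      using c(2)[of w a] by (subst emeasure_spherical_measure[OF closed]) auto
  qed
qed

section \<open>Dual volume\<close>

lemma class_G_I_mono:
  "G \<in> class_G_I \<Longrightarrow> v \<in> sphere 0 1 \<Longrightarrow> 0 < s \<Longrightarrow> s \<le> t \<Longrightarrow> G s v \<le> G t v"
  unfolding class_G_I_def by (cases "s = t") (auto simp: strict_mono_on_def intro: less_imp_le)

lemma class_G_I_pos: "G \<in> class_G_I \<Longrightarrow> v \<in> sphere 0 1 \<Longrightarrow> 0 < t \<Longrightarrow> 0 < G t v"
  unfolding class_G_I_def by auto

lemma class_G_I_continuous_on:
  fixes G :: "real \<Rightarrow> real ^ 'n \<Rightarrow> real"
  assumes "G \<in> class_G_I" "continuous_on (sphere 0 1) f" "\<And>v. v \<in> sphere 0 1 \<Longrightarrow> 0 < f v"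
  shows "continuous_on (sphere 0 1) (\<lambda>v. G (f v) v)"
proof -
  have "continuous_on ({0<..} \<times> sphere 0 1) (\<lambda>(t, v). G t v)"
    using assms(1) by (simp add: class_G_I_def)
  moreover have "continuous_on (sphere 0 1) (\<lambda>v. (f v, v))"
    by (intro continuous_intros assms)
  ultimately have "continuous_on (sphere 0 1) (\<lambda>v. (\<lambda>(t, v). G t v) (f v, v))"
    by (rule continuous_on_compose2) (use assms in auto)
  then show ?thesis by simp
qed

text \<open>By monotonicity the integrands are dominated by the maximum of \<open>G b\<close> over
  the compact sphere, a constant and so integrable for a finite measure. Off the null set
  \<open>A\<close> they tend to 0, since \<open>G\<close> does as its first argument tends to
  0.\<close>

lemma nn_integral_class_G_I_tendsto_0:
  fixes G :: "real \<Rightarrow> real ^ 'n \<Rightarrow> real"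
  assumes G: "G \<in> class_G_I" and b: "0 < b"
    and f: "\<And>k::nat. continuous_on (sphere 0 1) (f k)"
      "\<And>k v. v \<in> sphere 0 1 \<Longrightarrow> 0 < f k v \<and> f k v \<le> b"
    and A: "finite A" "A \<subseteq> sphere 0 1" "\<And>v. v \<in> sphere 0 1 - A \<Longrightarrow> (\<lambda>k. f k v) \<longlonglongrightarrow> 0"
  shows "(\<lambda>k. \<integral>\<^sup>+v. ennreal (G (f k v) v) \<partial>spherical_measure) \<longlonglongrightarrow> 0"
proof -
  have cont: "continuous_on (sphere 0 1) (\<lambda>v. G b v)"
    using b by (intro class_G_I_continuous_on[OF G]) auto
  obtain M where "\<forall>x\<in>(\<lambda>v. G b v) ` sphere 0 1. norm x \<le> M"
    using compact_imp_bounded[OF compact_continuous_image[OF cont compact_sphere]]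
    unfolding bounded_iff by blast
  then have M: "G b v \<le> M" if "v \<in> sphere 0 1" for v
    using that abs_le_D1[of "G b v" M] by simp
  interpret finite_measure "spherical_measure :: (real ^ 'n) measure"
    by (rule finite_measure_spherical_measure)
  have "(\<lambda>k. \<integral>\<^sup>+v. ennreal (G (f k v) v) \<partial>spherical_measure)
      \<longlonglongrightarrow> (\<integral>\<^sup>+(v::real ^ 'n). 0 \<partial>spherical_measure)"
  proof (rule nn_integral_dominated_convergence)
    show "(\<lambda>v. ennreal (G (f k v) v)) \<in> borel_measurable spherical_measure" for k
      using f by (intro measurable_compose[OF borel_measurable_spherical_measure measurable_ennreal]
          class_G_I_continuous_on[OF G]) auto
    show "(\<lambda>v::real ^ 'n. ennreal M) \<in> borel_measurable spherical_measure" by simp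
    show "AE v in spherical_measure. ennreal (G (f k v) v) \<le> ennreal M" for k
    proof (intro AE_I2 ennreal_leI)
      fix v :: "real ^ 'n" assume "v \<in> space spherical_measure"
      then have v: "v \<in> sphere 0 1" by (simp add: space_spherical_measure)
      then show "G (f k v) v \<le> M"
        using class_G_I_mono[OF G v, of "f k v" b] f(2)[OF v, of k] M[OF v] by linarith
    qed
    show "(\<integral>\<^sup>+(v::real ^ 'n). ennreal M \<partial>spherical_measure) < \<infinity>"
      using emeasure_finite[of "space spherical_measure"]
      by (simp add: ennreal_mult_eq_top_iff less_top[symmetric])
    have "(\<lambda>k. G (f k v) v) \<longlonglongrightarrow> 0" if "v \<in> sphere 0 1 - A" for v
    proof -
      have "((\<lambda>t. G t v) \<longlongrightarrow> 0) (at_right 0)"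
        using G that by (simp add: class_G_I_def)
      moreover have "filterlim (\<lambda>k. f k v) (at_right 0) sequentially"
        using A(3)[OF that] f(2) that
        by (intro tendsto_imp_filterlim_at_right always_eventually) auto
      ultimately show ?thesis by (rule filterlim_compose)
    qed
    then have "(\<lambda>k. ennreal (G (f k v) v)) \<longlonglongrightarrow> 0" if "v \<in> sphere 0 1 - A" for v
      using that tendsto_ennrealI[of "\<lambda>k. G (f k v) v" 0] by simp
    then show "AE v in spherical_measure. (\<lambda>k. ennreal (G (f k v) v)) \<longlonglongrightarrow> 0"
      using spherical_measure_finite_null[OF A(1,2)]
      by (intro AE_I'[of A]) (auto simp: space_spherical_measure)
  qed simp
  then show ?thesis by simp
qed

section \<open>Radial functions and estimates of the dual volume\<close>

definition dual_integral :: "(real \<Rightarrow> real ^ 'n \<Rightarrow> real) \<Rightarrow> (real ^ 'n) set \<Rightarrow> real \<Rightarrow> ennreal" where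
  "dual_integral G K \<eta> = (\<integral>\<^sup>+v. ennreal (G (radial_fun K v / \<eta>) v) \<partial>spherical_measure)"

lemma dual_volume_eq: "dual_volume G K = Inf {\<eta>. 0 < \<eta> \<and> dual_integral G K \<eta> \<le> 1}"
  by (simp add: dual_volume_def dual_integral_def)

text \<open>\<open>N\<close> is the gauge of \<open>K\<close> at \<open>v\<close>; for slabs and
  spindles it is an explicit maximum.\<close>

lemma radial_fun_eqI:
  assumes "0 < N" "\<And>t. 0 \<le> t \<Longrightarrow> t *\<^sub>R v \<in> K \<longleftrightarrow> t * N \<le> 1"
  shows "radial_fun K v = 1 / N"
proof -
  have "{t. 0 \<le> t \<and> t *\<^sub>R v \<in> K} = {0..1 / N}"
    using assms by (auto simp: field_simps)
  then show ?thesis using assms(1) by (simp add: radial_fun_def)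
qed

lemma radial_fun_bounds:
  assumes "K \<in> convex_bodies_o"
  obtains r R where "0 < r" "\<And>v. v \<in> sphere 0 1 \<Longrightarrow> r \<le> radial_fun K v \<and> radial_fun K v \<le> R"
proof -
  obtain r where r: "0 < r" "cball 0 r \<subseteq> K"
    using assms mem_interior_cball[of 0 K] by (auto simp: convex_bodies_o_def)
  obtain R where R: "\<And>x. x \<in> K \<Longrightarrow> norm x \<le> R"
    using assms compact_imp_bounded[of K] by (auto simp: convex_bodies_o_def bounded_iff)
  have "r \<le> radial_fun K v \<and> radial_fun K v \<le> R" if v: "v \<in> sphere 0 1" for v
  proof -
    have ub: "t \<le> R" if "t \<in> {t. 0 \<le> t \<and> t *\<^sub>R v \<in> K}" for t using R[of "t *\<^sub>R v"] that v by auto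
    have "r \<in> {t. 0 \<le> t \<and> t *\<^sub>R v \<in> K}" using r v by auto
    then show ?thesis
      unfolding radial_fun_def using ub by (intro conjI cSup_upper cSup_least bdd_aboveI) auto
  qed
  then show ?thesis using that r(1) by blast
qed

lemma dual_integral_mono:
  fixes G :: "real \<Rightarrow> real ^ 'n \<Rightarrow> real"
  assumes "G \<in> class_G_I" "\<And>v. v \<in> sphere 0 1 \<Longrightarrow> 0 < f v \<and> f v \<le> radial_fun K v / \<eta>"
  shows "(\<integral>\<^sup>+v. ennreal (G (f v) v) \<partial>spherical_measure) \<le> dual_integral G K \<eta>"
  unfolding dual_integral_def
proof (intro nn_integral_mono ennreal_leI)
  fix v :: "real ^ 'n" assume "v \<in> space spherical_measure"
  then have v: "v \<in> sphere 0 1" by (simp add: space_spherical_measure)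
  then show "G (f v) v \<le> G (radial_fun K v / \<eta>) v"
    using assms(2)[OF v] class_G_I_mono[OF assms(1) v] by blast
qed

lemma dual_volume_le: "0 < \<eta> \<Longrightarrow> dual_integral G K \<eta> \<le> 1 \<Longrightarrow> dual_volume G K \<le> \<eta>"
  unfolding dual_volume_eq by (intro cInf_lower bdd_belowI[of _ 0]) auto

text \<open>Needed because \<open>Inf\<close> of the empty set says nothing about its argument.
  Large values of \<open>\<eta>\<close> are admissible, as the integral tends to 0 along the
  integers.\<close>

lemma ex_dual_integral_le_1:
  fixes G :: "real \<Rightarrow> real ^ 'n \<Rightarrow> real"
  assumes G: "G \<in> class_G_I" and K: "K \<in> convex_bodies_o"
  shows "{\<eta>. 0 < \<eta> \<and> dual_integral G K \<eta> \<le> 1} \<noteq> {}"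
proof -
  obtain r R where r: "0 < r" "\<And>v. v \<in> sphere 0 1 \<Longrightarrow> r \<le> radial_fun K v \<and> radial_fun K v \<le> R"
    using radial_fun_bounds[OF K] by blast
  \<comment> \<open>The maximum with \<open>r\<close> makes the upper bound positive without
    choosing a direction.\<close>
  define R' where "R' = max R r"
  have R': "0 < R'" "\<And>v. v \<in> sphere 0 1 \<Longrightarrow> radial_fun K v \<le> R'"
    using r by (auto simp: R'_def intro: le_max_iff_disj[THEN iffD2])
  have "(\<lambda>k. \<integral>\<^sup>+(v::real ^ 'n). ennreal (G (R' / real (Suc k)) v) \<partial>spherical_measure) \<longlonglongrightarrow> 0"
  proof (rule nn_integral_class_G_I_tendsto_0[OF G R'(1), where A = "{}"])
    show "0 < R' / real (Suc k) \<and> R' / real (Suc k) \<le> R'" for k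
      using R'(1) by (auto simp: field_simps)
    show "(\<lambda>k. R' / real (Suc k)) \<longlonglongrightarrow> 0"
      by (rule LIMSEQ_Suc) (rule lim_const_over_n)
  qed (auto intro: continuous_intros)
  then have "eventually (\<lambda>k. (\<integral>\<^sup>+v. ennreal (G (R' / real (Suc k)) v) \<partial>spherical_measure) < 1) sequentially"
    by (rule order_tendstoD) simp
  then obtain k where k: "(\<integral>\<^sup>+v. ennreal (G (R' / real (Suc k)) v) \<partial>spherical_measure) < 1"
    by (auto simp: eventually_sequentially)
  have "dual_integral G K (real (Suc k)) \<le> (\<integral>\<^sup>+v. ennreal (G (R' / real (Suc k)) v) \<partial>spherical_measure)"
    unfolding dual_integral_def
  proof (intro nn_integral_mono ennreal_leI class_G_I_mono[OF G])
    fix v :: "real ^ 'n" assume "v \<in> space spherical_measure"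
    then have v: "v \<in> sphere 0 1" by (simp add: space_spherical_measure)
    then show "v \<in> sphere 0 1" .
    have "0 < radial_fun K v" "radial_fun K v \<le> R'" using r(1) r(2)[OF v] R'(2)[OF v] by auto
    then show "0 < radial_fun K v / real (Suc k)" "radial_fun K v / real (Suc k) \<le> R' / real (Suc k)"
      by (simp_all add: divide_right_mono)
  qed
  with k have "dual_integral G K (real (Suc k)) \<le> 1" by simp
  moreover have "0 < real (Suc k)" by simp
  ultimately show ?thesis by blast
qed

lemma dual_volume_ge:
  fixes G :: "real \<Rightarrow> real ^ 'n \<Rightarrow> real"
  assumes "G \<in> class_G_I" "K \<in> convex_bodies_o"
    and T: "\<And>\<eta>. 0 < \<eta> \<Longrightarrow> \<eta> < T \<Longrightarrow> 1 < dual_integral G K \<eta>"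
  shows "T \<le> dual_volume G K"
  unfolding dual_volume_eq
proof (rule cInf_greatest)
  show "{\<eta>. 0 < \<eta> \<and> dual_integral G K \<eta> \<le> 1} \<noteq> {}"
    using assms(1,2) by (rule ex_dual_integral_le_1)
  fix \<eta> assume "\<eta> \<in> {\<eta>. 0 < \<eta> \<and> dual_integral G K \<eta> \<le> 1}"
  then show "T \<le> \<eta>" using T[of \<eta>] by (auto simp: not_less[symmetric])
qed

lemma convex_bodies_oI:
  assumes "convex K" "compact K" "0 < r" "ball 0 r \<subseteq> K"
  shows "K \<in> convex_bodies_o"
  using assms by (auto simp: convex_bodies_o_def intro: interiorI[of "ball 0 r"])

section \<open>Slabs have large dual volume\<close>

text \<open>A geometric sum with ratio 2 is at most twice its largest term. This bounds the radial
  function of a slab below by weighted indicators of bands, whose measures are under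
  control.\<close>

lemma sum_dyadic_le:
  fixes t :: real
  assumes "0 \<le> t"
  shows "(\<Sum>k\<le>N. 2 ^ k * (if t \<le> 1 / 2 ^ k then 1 else 0)) \<le> 2 / max t (1 / 2 ^ N)"
proof (induction N)
  case 0
  show ?case using assms by (simp add: max_def)
next
  case (Suc N)
  show ?case
  proof (cases "t \<le> 1 / 2 ^ Suc N")
    case True
    have "(\<Sum>k\<le>Suc N. 2 ^ k * (if t \<le> 1 / 2 ^ k then 1 else 0)) \<le> (\<Sum>k\<le>Suc N. (2::real) ^ k)"
      by (intro sum_mono) auto
    also have "\<dots> \<le> 2 * 2 ^ Suc N"
      using sum_gp_multiplied[of 0 "Suc N" "2::real"] by (simp add: atMost_atLeast0)
    also have "\<dots> = 2 / max t (1 / 2 ^ Suc N)" using True by (simp add: max_def)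
    finally show ?thesis .
  next
    case False
    then have "(\<Sum>k\<le>Suc N. 2 ^ k * (if t \<le> 1 / 2 ^ k then 1 else 0)) =
      (\<Sum>k\<le>N. 2 ^ k * (if t \<le> 1 / 2 ^ k then 1 else (0::real)))" by simp
    also have "\<dots> \<le> 2 / max t (1 / 2 ^ N)" by (rule Suc)
    also have "\<dots> \<le> 2 / max t (1 / 2 ^ Suc N)"
      using assms by (intro divide_left_mono max.mono mult_pos_pos) (auto simp: less_max_iff_disj divide_simps)
    finally show ?thesis .
  qed
qed

text \<open>The band \<open>B k\<close> has measure at least \<open>c / 2 ^ k\<close> and enters
  with weight \<open>2 ^ k\<close>, so every dyadic layer contributes the same amount to the lower
  bound; enough layers push the integral above 1.\<close>

lemma dual_volume_slab_ge:
  fixes G :: "real \<Rightarrow> real ^ 'n \<Rightarrow> real"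
  assumes card: "2 \<le> CARD('n)" and G: "G \<in> class_G_I"
    and c0: "0 < c0" "\<forall>t\<ge>1. \<forall>v\<in>sphere 0 1. c0 * t \<le> G t v"
    and w: "norm w = 1" and T: "1 \<le> T"
  obtains N :: nat where "{x. \<bar>x \<bullet> w\<bar> \<le> 1 \<and> norm x \<le> 2 ^ N} \<in> convex_bodies_o"
    "T \<le> dual_volume G {x. \<bar>x \<bullet> w\<bar> \<le> 1 \<and> norm x \<le> 2 ^ N}"
proof -
  obtain c where c: "0 < c" "\<And>(w::real ^ 'n) a. norm w = 1 \<Longrightarrow> 0 < a \<Longrightarrow> a \<le> 1 \<Longrightarrow>
    ennreal (c * a) \<le> emeasure spherical_measure {x \<in> sphere 0 1. \<bar>x \<bullet> w\<bar> \<le> a}"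
    using spherical_measure_band_ge[OF card] by blast
  \<comment> \<open>On the band of index \<open>k0\<close> the radial function is at least
    \<open>2 ^ k0\<close>, hence at least \<open>T\<close>. There the argument of \<open>G\<close>
    is at least 1 and the growth bound applies.\<close>
  obtain k0 :: nat where k0: "T \<le> 2 ^ k0"
    using real_arch_pow[of 2 T] by (auto intro: less_imp_le)
  \<comment> \<open>Each of the \<open>L\<close> bands of index \<open>Suc k0\<close> to
    \<open>N\<close> will contribute at least \<open>c0 / (2 * T) * c\<close>.\<close>
  obtain L :: nat where L: "1 < c0 / (2 * T) * c * real L"
  proof -
    have "0 < c0 / (2 * T) * c" using c0(1) c(1) T by simp
    then obtain L :: nat where "1 < real L * (c0 / (2 * T) * c)"
      using reals_Archimedean3 by blast
    then show ?thesis using that by (simp add: mult.commute)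
  qed
  define N where "N = k0 + L"
  define K where "K = {x. \<bar>x \<bullet> w\<bar> \<le> 1 \<and> norm x \<le> 2 ^ N}"
  have K: "K \<in> convex_bodies_o"
  proof (rule convex_bodies_oI[of _ 1])
    have eq: "K = (\<lambda>x. x \<bullet> w) -` {-1..1} \<inter> cball 0 (2 ^ N)"
      by (auto simp: K_def abs_le_iff)
    show "convex K" unfolding eq
      by (intro convex_Int convex_linear_vimage bounded_linear.linear bounded_linear_inner_left) auto
    show "compact K" unfolding eq Int_commute[of _ "cball 0 (2 ^ N)"]
      by (intro compact_Int_closed compact_cball closed_vimage continuous_intros)
    show "ball 0 1 \<subseteq> K"
    proof
      fix x :: "real ^ 'n" assume "x \<in> ball 0 1"
      then have x: "norm x < 1" by simp
      moreover have "\<bar>x \<bullet> w\<bar> \<le> norm x" using Cauchy_Schwarz_ineq2[of x w] w by simp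
      moreover have "(1::real) \<le> 2 ^ N" by simp
      ultimately have "\<bar>x \<bullet> w\<bar> \<le> 1" "norm x \<le> 2 ^ N" by linarith+
      then show "x \<in> K" by (simp add: K_def)
    qed
  qed simp
  have rad: "radial_fun K v = 1 / max \<bar>v \<bullet> w\<bar> (1 / 2 ^ N)" if "v \<in> sphere 0 1" for v
  proof (rule radial_fun_eqI)
    show "0 < max \<bar>v \<bullet> w\<bar> (1 / 2 ^ N)" by (simp add: less_max_iff_disj)
    show "t *\<^sub>R v \<in> K \<longleftrightarrow> t * max \<bar>v \<bullet> w\<bar> (1 / 2 ^ N) \<le> 1" if "0 \<le> t" for t
      using that \<open>v \<in> sphere 0 1\<close>
      by (simp add: K_def abs_mult max_mult_distrib_left divide_le_eq)
  qed
  define B where "B = (\<lambda>k::nat. {x \<in> sphere 0 1. \<bar>x \<bullet> w\<bar> \<le> 1 / 2 ^ k})"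
  have closed: "closed (B k)" for k
    unfolding B_def Collect_conj_eq Collect_mem_eq
    by (intro closed_Int closed_sphere closed_Collect_le continuous_intros)
  have B: "B k \<in> sets spherical_measure" for k
    by (intro closed_in_sets_spherical_measure closed) (auto simp: B_def)
  \<comment> \<open>Only bands of index above \<open>k0\<close> enter, so off the band of index
    \<open>k0\<close> the left side is 0 and positivity of \<open>G\<close> suffices.\<close>
  have pointwise: "c0 / (2 * T) * (\<Sum>k\<in>{Suc k0..N}. 2 ^ k * indicator (B k) v) \<le> G (radial_fun K v / T) v"
    if v: "v \<in> sphere 0 1" for v
  proof -
    have pos: "0 < radial_fun K v" using rad[OF v] by (simp add: less_max_iff_disj)
    show ?thesis
    proof (cases "\<bar>v \<bullet> w\<bar> \<le> 1 / 2 ^ k0")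
      case True
      have "2 ^ k0 \<le> radial_fun K v"
      proof -
        have "(1::real) / 2 ^ N \<le> 1 / 2 ^ k0" by (simp add: N_def divide_simps)
        then have "max \<bar>v \<bullet> w\<bar> (1 / 2 ^ N) \<le> 1 / 2 ^ k0" using True by simp
        then have "1 / (1 / 2 ^ k0) \<le> 1 / max \<bar>v \<bullet> w\<bar> (1 / 2 ^ N)"
          by (intro divide_left_mono mult_pos_pos) (auto simp: less_max_iff_disj)
        then show ?thesis using rad[OF v] by simp
      qed
      then have T1: "1 \<le> radial_fun K v / T" using k0 T by simp
      have "(\<Sum>k\<in>{Suc k0..N}. 2 ^ k * indicator (B k) v) \<le> (\<Sum>k\<le>N. 2 ^ k * indicator (B k) v :: real)"
        by (intro sum_mono2) auto
      also have "\<dots> = (\<Sum>k\<le>N. 2 ^ k * (if \<bar>v \<bullet> w\<bar> \<le> 1 / 2 ^ k then 1 else 0))"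
        using v by (intro sum.cong) (auto simp: B_def indicator_def)
      also have "\<dots> \<le> 2 * radial_fun K v"
        using sum_dyadic_le[of "\<bar>v \<bullet> w\<bar>" N] rad[OF v] by simp
      finally have "c0 / (2 * T) * (\<Sum>k\<in>{Suc k0..N}. 2 ^ k * indicator (B k) v) \<le> c0 / (2 * T) * (2 * radial_fun K v)"
        by (rule mult_left_mono) (use c0(1) T in simp)
      also have "\<dots> = c0 * (radial_fun K v / T)" by simp
      also have "\<dots> \<le> G (radial_fun K v / T) v" using c0(2) T1 v by blast
      finally show ?thesis .
    next
      case False
      have "v \<notin> B k" if "k \<in> {Suc k0..N}" for k
      proof
        assume "v \<in> B k"
        then have "\<bar>v \<bullet> w\<bar> \<le> 1 / 2 ^ k" by (simp add: B_def)
        also have "\<dots> \<le> 1 / 2 ^ k0" using that by (intro divide_left_mono power_increasing) auto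
        finally show False using False by simp
      qed
      then have "(\<Sum>k\<in>{Suc k0..N}. 2 ^ k * indicator (B k) v) = (0::real)"
        by (intro sum.neutral ballI) simp
      moreover have "0 < G (radial_fun K v / T) v"
        using pos T by (intro class_G_I_pos[OF G v]) simp
      ultimately show ?thesis by simp
    qed
  qed
  have "1 < dual_integral G K \<eta>" if \<eta>: "0 < \<eta>" "\<eta> < T" for \<eta>
  proof -
    have "1 < ennreal (c0 / (2 * T) * c * real L)" using L by simp
    also have "\<dots> = ennreal (c0 / (2 * T)) * (\<Sum>k\<in>{Suc k0..N}. ennreal (2 ^ k) * ennreal (c * (1 / 2 ^ k)))"
      using c0(1) c(1) T by (simp add: N_def ennreal_of_nat_eq_real_of_nat mult_ac flip: ennreal_mult)
    also have "\<dots> \<le> ennreal (c0 / (2 * T)) * (\<Sum>k\<in>{Suc k0..N}. ennreal (2 ^ k) * emeasure spherical_measure (B k))"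
      unfolding B_def by (intro mult_left_mono sum_mono c(2)[OF w]) auto
    also have "\<dots> = (\<integral>\<^sup>+v. ennreal (c0 / (2 * T)) * (\<Sum>k\<in>{Suc k0..N}. ennreal (2 ^ k) * indicator (B k) v) \<partial>spherical_measure)"
      using B by (subst nn_integral_cmult, measurable, subst nn_integral_sum, measurable)
        (simp add: nn_integral_cmult_indicator)
    also have "\<dots> \<le> (\<integral>\<^sup>+v. ennreal (G (radial_fun K v / T) v) \<partial>spherical_measure)"
    proof (rule nn_integral_mono)
      fix v :: "real ^ 'n" assume "v \<in> space spherical_measure"
      then have v: "v \<in> sphere 0 1" by (simp add: space_spherical_measure)
      have "ennreal (c0 / (2 * T)) * (\<Sum>k\<in>{Suc k0..N}. ennreal (2 ^ k) * indicator (B k) v) =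
        ennreal (c0 / (2 * T) * (\<Sum>k\<in>{Suc k0..N}. 2 ^ k * indicator (B k) v))"
      proof -
        have "(\<Sum>k\<in>{Suc k0..N}. ennreal (2 ^ k) * indicator (B k) v) =
          ennreal (\<Sum>k\<in>{Suc k0..N}. 2 ^ k * indicator (B k) v)"
          by (subst sum_ennreal[symmetric]) (auto simp: ennreal_mult ennreal_indicator)
        moreover have "0 \<le> c0 / (2 * T)" using c0(1) T by simp
        ultimately show ?thesis by (simp only: ennreal_mult')
      qed
      also have "\<dots> \<le> ennreal (G (radial_fun K v / T) v)"
        using pointwise[OF v] by (rule ennreal_leI)
      finally show "ennreal (c0 / (2 * T)) * (\<Sum>k\<in>{Suc k0..N}. ennreal (2 ^ k) * indicator (B k) v)
        \<le> ennreal (G (radial_fun K v / T) v)" .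
    qed
    \<comment> \<open>The estimate was made at \<open>T\<close>; a smaller \<open>\<eta>\<close>
      only enlarges the argument of \<open>G\<close>.\<close>
    also have "\<dots> \<le> dual_integral G K \<eta>"
    proof (rule dual_integral_mono[OF G])
      fix v :: "real ^ 'n" assume "v \<in> sphere 0 1"
      then have "0 < radial_fun K v" by (simp add: rad less_max_iff_disj)
      then show "0 < radial_fun K v / T \<and> radial_fun K v / T \<le> radial_fun K v / \<eta>"
        using \<eta> T by (auto intro!: divide_left_mono)
    qed
    finally show ?thesis .
  qed
  then have "T \<le> dual_volume G K" by (rule dual_volume_ge[OF G K])
  then show ?thesis using that K unfolding K_def by blast
qed

section \<open>Positivity and homogeneity of the dual volume, and polarity\<close>

lemma dual_volume_pos:
  fixes G :: "real \<Rightarrow> real ^ 'n \<Rightarrow> real"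
  assumes card: "2 \<le> CARD('n)" and G: "G \<in> class_G_I"
    and c0: "0 < c0" "\<forall>t\<ge>1. \<forall>v\<in>sphere 0 1. c0 * t \<le> G t v"
    and K: "K \<in> convex_bodies_o"
  shows "0 < dual_volume G K"
proof -
  obtain r R where r: "0 < r" "\<And>v. v \<in> sphere 0 1 \<Longrightarrow> r \<le> radial_fun K v \<and> radial_fun K v \<le> R"
    using radial_fun_bounds[OF K] by blast
  obtain c where c: "0 < c" "\<And>(w::real ^ 'n) a. norm w = 1 \<Longrightarrow> 0 < a \<Longrightarrow> a \<le> 1 \<Longrightarrow>
    ennreal (c * a) \<le> emeasure spherical_measure {x \<in> sphere 0 1. \<bar>x \<bullet> w\<bar> \<le> a}"
    using spherical_measure_band_ge[OF card] by blast
  obtain w :: "real ^ 'n" where w: "norm w = 1" using vector_choose_size[of 1] by auto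
  have "{x \<in> sphere 0 1. \<bar>x \<bullet> w\<bar> \<le> 1} \<subseteq> space spherical_measure"
    by (auto simp: space_spherical_measure)
  then have total: "ennreal c \<le> emeasure spherical_measure (space (spherical_measure :: (real ^ 'n) measure))"
    using order_trans[OF c(2)[OF w, of 1] emeasure_mono[OF _ sets.top]] by simp
  \<comment> \<open>Below \<open>r\<close>, the quotient \<open>r / \<eta>\<close> exceeds 1 and the
    growth bound applies; below \<open>c0 * r * c\<close>, the resulting lower bound
    \<open>c0 * (r / \<eta>) * c\<close> for the integral exceeds 1.\<close>
  have "min r (c0 * r * c) \<le> dual_volume G K"
  proof (rule dual_volume_ge[OF G K])
    fix \<eta> assume \<eta>: "0 < \<eta>" "\<eta> < min r (c0 * r * c)"
    have "1 < ennreal (c0 * (r / \<eta>) * c)" using \<eta> by (simp add: field_simps)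
    also have "\<dots> = ennreal (c0 * (r / \<eta>)) * ennreal c"
      using c0(1) r(1) c(1) \<eta> by (intro ennreal_mult) auto
    also have "\<dots> \<le> ennreal (c0 * (r / \<eta>)) * emeasure spherical_measure (space (spherical_measure :: (real ^ 'n) measure))"
      by (intro mult_left_mono total) simp
    also have "\<dots> = (\<integral>\<^sup>+(v::real ^ 'n). ennreal (c0 * (r / \<eta>)) \<partial>spherical_measure)" by simp
    also have "\<dots> \<le> (\<integral>\<^sup>+v. ennreal (G (r / \<eta>) v) \<partial>spherical_measure)"
      using \<eta> by (intro nn_integral_mono ennreal_leI c0(2)[rule_format])
        (auto simp: space_spherical_measure)
    also have "\<dots> \<le> dual_integral G K \<eta>"
      using r \<eta> by (intro dual_integral_mono[OF G]) (simp add: divide_right_mono)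
    finally show "1 < dual_integral G K \<eta>" .
  qed
  moreover have "0 < min r (c0 * r * c)" using r(1) c0(1) c(1) by simp
  ultimately show ?thesis by linarith
qed

lemma radial_fun_scaleR:
  assumes K: "K \<in> convex_bodies_o" and s: "0 < s" and v: "v \<in> sphere 0 1"
  shows "radial_fun ((*\<^sub>R) s ` K) v = s * radial_fun K v"
proof -
  let ?A = "{t. 0 \<le> t \<and> t *\<^sub>R v \<in> K}"
  obtain R where R: "\<And>x. x \<in> K \<Longrightarrow> norm x \<le> R"
    using K compact_imp_bounded[of K] by (auto simp: convex_bodies_o_def bounded_iff)
  have bdd: "bdd_above ?A"
  proof (rule bdd_aboveI)
    show "t \<le> R" if "t \<in> ?A" for t using R[of "t *\<^sub>R v"] that v by auto
  qed
  have "0 \<in> K" using K interior_subset by (auto simp: convex_bodies_o_def)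
  then have ne: "?A \<noteq> {}" by (auto intro!: exI[of _ 0])
  have "{t. 0 \<le> t \<and> t *\<^sub>R v \<in> (*\<^sub>R) s ` K} = (*) s ` ?A"
  proof (intro equalityI subsetI)
    fix t assume "t \<in> {t. 0 \<le> t \<and> t *\<^sub>R v \<in> (*\<^sub>R) s ` K}"
    then obtain x where t: "0 \<le> t" "t *\<^sub>R v = s *\<^sub>R x" "x \<in> K" by auto
    then have "(t / s) *\<^sub>R v = x" using s by (metis divideR_right divide_inverse_commute scaleR_scaleR less_irrefl)
    then have "t / s \<in> ?A" "t = s * (t / s)" using t s by auto
    then show "t \<in> (*) s ` ?A" by blast
  next
    fix t assume "t \<in> (*) s ` ?A"
    then obtain t' where "t = s * t'" "0 \<le> t'" "t' *\<^sub>R v \<in> K" by auto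
    then show "t \<in> {t. 0 \<le> t \<and> t *\<^sub>R v \<in> (*\<^sub>R) s ` K}" using s by (auto intro!: image_eqI[of _ _ "t' *\<^sub>R v"])
  qed
  moreover have "s * Sup ?A = Sup ((*) s ` ?A)"
    using s by (intro continuous_at_Sup_mono bdd ne monoI continuous_intros) auto
  ultimately show ?thesis by (simp add: radial_fun_def)
qed

text \<open>Scaling both the body and \<open>\<eta>\<close> by \<open>s\<close> leaves the integrand
  unchanged, so the set of admissible \<open>\<eta>\<close> is scaled by \<open>s\<close>.\<close>

lemma dual_volume_scaleR:
  fixes G :: "real \<Rightarrow> real ^ 'n \<Rightarrow> real"
  assumes G: "G \<in> class_G_I" and K: "K \<in> convex_bodies_o" and s: "0 < s"
  shows "dual_volume G ((*\<^sub>R) s ` K) = s * dual_volume G K"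
proof -
  have I: "dual_integral G ((*\<^sub>R) s ` K) (s * \<eta>) = dual_integral G K \<eta>" for \<eta>
    unfolding dual_integral_def using s
    by (intro nn_integral_cong) (simp add: radial_fun_scaleR[OF K s] space_spherical_measure)
  let ?A = "{\<eta>. 0 < \<eta> \<and> dual_integral G K \<eta> \<le> 1}"
  have "{\<eta>. 0 < \<eta> \<and> dual_integral G ((*\<^sub>R) s ` K) \<eta> \<le> 1} = (*) s ` ?A"
  proof (intro equalityI subsetI)
    fix \<eta> assume \<eta>: "\<eta> \<in> {\<eta>. 0 < \<eta> \<and> dual_integral G ((*\<^sub>R) s ` K) \<eta> \<le> 1}"
    have "\<eta> = s * (\<eta> / s)" using s by simp
    moreover have "\<eta> / s \<in> ?A" using \<eta> s I[of "\<eta> / s"] by simp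
    ultimately show "\<eta> \<in> (*) s ` ?A" by blast
  qed (use s I in auto)
  moreover have "s * Inf ?A = Inf ((*) s ` ?A)"
    using s by (intro continuous_at_Inf_mono ex_dual_integral_le_1[OF G K] monoI continuous_intros
        bdd_belowI[of _ 0]) auto
  ultimately show ?thesis by (simp add: dual_volume_eq)
qed

lemma convex_bodies_o_scaleR:
  assumes "K \<in> convex_bodies_o" "0 < s"
  shows "(*\<^sub>R) s ` K \<in> convex_bodies_o"
proof -
  obtain r where r: "0 < r" "cball 0 r \<subseteq> K"
    using assms mem_interior_cball[of 0 K] by (auto simp: convex_bodies_o_def)
  show ?thesis
  proof (rule convex_bodies_oI)
    show "convex ((*\<^sub>R) s ` K)" "compact ((*\<^sub>R) s ` K)"
      using assms by (auto simp: convex_bodies_o_def intro: convex_scaling compact_scaling)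
    show "0 < s * r" using r assms by simp
    show "ball 0 (s * r) \<subseteq> (*\<^sub>R) s ` K"
    proof
      fix x :: "real ^ 'a" assume "x \<in> ball 0 (s * r)"
      then have "norm (inverse s *\<^sub>R x) \<le> r" using assms(2) by (simp add: field_simps)
      then have "inverse s *\<^sub>R x \<in> K" using r by auto
      moreover have "x = s *\<^sub>R (inverse s *\<^sub>R x)" using assms(2) by simp
      ultimately show "x \<in> (*\<^sub>R) s ` K" by blast
    qed
  qed
qed

text \<open>A ball of radius \<open>r\<close> inside \<open>K\<close> bounds the polar by
  \<open>1 / r\<close>, and a bound \<open>R\<close> on the norms in \<open>K\<close> puts the ball
  of radius \<open>1 / R\<close> into the polar.\<close>

lemma polar_body_convex_bodies_o:
  fixes K :: "(real ^ 'n) set"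
  assumes "K \<in> convex_bodies_o"
  shows "polar_body K \<in> convex_bodies_o"
proof -
  obtain r where r: "0 < r" "cball 0 r \<subseteq> K"
    using assms mem_interior_cball[of 0 K] by (auto simp: convex_bodies_o_def)
  obtain R where R: "0 < R" "\<And>x. x \<in> K \<Longrightarrow> norm x \<le> R"
    using assms compact_imp_bounded[of K] by (auto simp: convex_bodies_o_def bounded_pos)
  have eq: "polar_body K = (\<Inter>y\<in>K. {x. y \<bullet> x \<le> 1})"
    by (auto simp: polar_body_def inner_commute)
  have "norm x \<le> 1 / r" if x: "x \<in> polar_body K" for x
  proof (cases "x = 0")
    case False
    have "(r / norm x) *\<^sub>R x \<in> K" using r False by auto
    then have "x \<bullet> ((r / norm x) *\<^sub>R x) \<le> 1" using x by (auto simp: polar_body_def)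
    then have "r * norm x \<le> 1" using False by (simp add: dot_square_norm power2_eq_square)
    then show ?thesis using r by (simp add: field_simps)
  qed (use r in simp)
  then have "bounded (polar_body K)" by (auto simp: bounded_iff)
  moreover have "closed (polar_body K)" unfolding eq by (intro closed_INT ballI closed_halfspace_le)
  ultimately have "compact (polar_body K)" by (simp add: compact_eq_bounded_closed)
  moreover have "convex (polar_body K)" unfolding eq by (intro convex_INT convex_halfspace_le)
  moreover have "ball 0 (1 / R) \<subseteq> polar_body K"
  proof
    fix x :: "real ^ 'n" assume x: "x \<in> ball 0 (1 / R)"
    have "x \<bullet> y \<le> 1" if "y \<in> K" for y
    proof -
      have "x \<bullet> y \<le> norm x * norm y" by (rule norm_cauchy_schwarz)
      also have "\<dots> \<le> 1 / R * R" using x R(1) R(2)[OF that] by (intro mult_mono) auto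
      finally show ?thesis using R(1) by simp
    qed
    then show "x \<in> polar_body K" by (simp add: polar_body_def)
  qed
  ultimately show ?thesis using R(1) by (intro convex_bodies_oI[of _ "1 / R"]) auto
qed

text \<open>A point \<open>z\<close> outside \<open>K\<close> is separated from \<open>K\<close> by
  a hyperplane. Its normal, rescaled to level 1, belongs to the polar and has inner product above 1
  with \<open>z\<close>.\<close>

lemma polar_body_polar_body:
  fixes K :: "(real ^ 'n) set"
  assumes "K \<in> convex_bodies_o"
  shows "polar_body (polar_body K) = K"
proof (intro equalityI subsetI)
  fix z assume z: "z \<in> polar_body (polar_body K)"
  show "z \<in> K"
  proof (rule ccontr)
    assume "z \<notin> K"
    moreover have "convex K" "closed K" "0 \<in> K"
      using assms interior_subset by (auto simp: convex_bodies_o_def compact_imp_closed)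
    ultimately obtain a b where ab: "a \<bullet> z < b" "\<And>x. x \<in> K \<Longrightarrow> b < a \<bullet> x"
      using separating_hyperplane_closed_point[of K z] by blast
    \<comment> \<open>\<open>K\<close> is on the upper side of the hyperplane and contains the
      origin, so the level is negative and division by it reverses the inequalities.\<close>
    have b: "b < 0" using ab(2)[OF \<open>0 \<in> K\<close>] by simp
    have "(1 / b) *\<^sub>R a \<in> polar_body K"
      using ab(2) b by (auto simp: polar_body_def divide_le_eq intro: less_imp_le)
    moreover have "\<forall>y\<in>polar_body K. z \<bullet> y \<le> 1"
      using z by (simp add: polar_body_def[of "polar_body K"])
    ultimately have "z \<bullet> ((1 / b) *\<^sub>R a) \<le> 1" by blast
    then have "(a \<bullet> z) / b \<le> 1" by (simp add: inner_commute)
    moreover have "1 < (a \<bullet> z) / b" using ab(1) b by (simp add: less_divide_eq)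
    ultimately show False by linarith
  qed
next
  fix z assume "z \<in> K"
  then have "z \<bullet> x \<le> 1" if "x \<in> polar_body K" for x
    using that by (subst inner_commute) (auto simp: polar_body_def)
  then show "z \<in> polar_body (polar_body K)" by (simp add: polar_body_def[of "polar_body K"])
qed

lemma polar_body_scaleR:
  assumes "0 < s"
  shows "polar_body ((*\<^sub>R) s ` P) = (*\<^sub>R) (1 / s) ` polar_body P"
proof (intro equalityI subsetI)
  fix x assume "x \<in> polar_body ((*\<^sub>R) s ` P)"
  then have "s *\<^sub>R x \<in> polar_body P" by (simp add: polar_body_def)
  moreover have "x = (1 / s) *\<^sub>R (s *\<^sub>R x)" using assms by simp
  ultimately show "x \<in> (*\<^sub>R) (1 / s) ` polar_body P" by blast
qed (use assms in \<open>auto simp: polar_body_def\<close>)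

text \<open>By the bipolar theorem the polar of the scaled body is \<open>K\<close> scaled by
  \<open>1 / s\<close>; homogeneity then turns the normalization into the equation that defines
  \<open>s\<close>.\<close>

lemma scaled_polar_in_normalized_bodies:
  fixes G :: "real \<Rightarrow> real ^ 'n \<Rightarrow> real"
  assumes card: "2 \<le> CARD('n)" and G: "G \<in> class_G_I"
    and c0: "0 < c0" "\<forall>t\<ge>1. \<forall>v\<in>sphere 0 1. c0 * t \<le> G t v"
    and K: "K \<in> convex_bodies_o"
  defines "s \<equiv> dual_volume G K / dual_volume G (cball 0 1)"
  shows "0 < s" "(*\<^sub>R) s ` polar_body K \<in> normalized_bodies G"
proof -
  have B: "cball 0 1 \<in> (convex_bodies_o :: (real ^ 'n) set set)"
    by (rule convex_bodies_oI[of _ 1]) auto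
  have pos: "0 < dual_volume G K" "0 < dual_volume G (cball 0 1)"
    using dual_volume_pos[OF card G c0] K B by blast+
  then show s: "0 < s" by (simp add: s_def)
  have "dual_volume G (polar_body ((*\<^sub>R) s ` polar_body K)) = 1 / s * dual_volume G K"
    using s by (simp add: polar_body_scaleR polar_body_polar_body[OF K] dual_volume_scaleR[OF G K])
  also have "\<dots> = dual_volume G (cball 0 1)" using pos by (simp add: s_def)
  finally show "(*\<^sub>R) s ` polar_body K \<in> normalized_bodies G"
    using convex_bodies_o_scaleR[OF polar_body_convex_bodies_o[OF K] s]
    by (simp add: normalized_bodies_def)
qed

section \<open>Normalized bodies with large or small support function\<close>

lemma inner_le_support_fun:
  assumes "K \<in> convex_bodies_o" "x \<in> K"
  shows "x \<bullet> v \<le> support_fun K v"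
proof -
  have "compact ((\<lambda>x. x \<bullet> v) ` K)"
    using assms by (intro compact_continuous_image continuous_intros) (auto simp: convex_bodies_o_def)
  then show ?thesis
    unfolding support_fun_def using assms(2)
    by (intro cSUP_upper bounded_imp_bdd_above compact_imp_bounded)
qed

lemma support_fun_pos:
  assumes K: "K \<in> convex_bodies_o" and v: "v \<in> sphere 0 1"
  shows "0 < support_fun K v"
proof -
  obtain r where r: "0 < r" "cball 0 r \<subseteq> K"
    using K mem_interior_cball[of 0 K] by (auto simp: convex_bodies_o_def)
  have "r *\<^sub>R v \<in> K" using r v by auto
  then have "(r *\<^sub>R v) \<bullet> v \<le> support_fun K v" by (rule inner_le_support_fun[OF K])
  then show ?thesis using r v by (simp add: dot_square_norm)
qed

text \<open>The polar of a slab contains \<open>w\<close> and \<open>- w\<close>, so the normalized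
  body contains the segment between \<open>s *\<^sub>R w\<close> and its negative. The large dual
  volume of the slab makes \<open>s\<close> large.\<close>

lemma ex_normalized_body_support_fun_ge:
  fixes G :: "real \<Rightarrow> real ^ 'n \<Rightarrow> real"
  assumes card: "2 \<le> CARD('n)" and G: "G \<in> class_G_I"
    and c0: "0 < c0" "\<forall>t\<ge>1. \<forall>v\<in>sphere 0 1. c0 * t \<le> G t v"
    and w: "norm w = 1"
  shows "\<exists>Q\<in>normalized_bodies G. \<forall>v. Y * \<bar>v \<bullet> w\<bar> \<le> support_fun Q v"
proof -
  define V where "V = dual_volume G (cball 0 1)"
  have "cball 0 1 \<in> (convex_bodies_o :: (real ^ 'n) set set)"
    by (rule convex_bodies_oI[of _ 1]) auto
  then have V: "0 < V" unfolding V_def by (rule dual_volume_pos[OF card G c0])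
  \<comment> \<open>Dual volume at least \<open>Y * V\<close> means \<open>s \<ge> Y\<close>; the
    maximum with 1 meets the hypothesis \<open>1 \<le> T\<close> of the slab estimate.\<close>
  obtain N :: nat where N: "{x. \<bar>x \<bullet> w\<bar> \<le> 1 \<and> norm x \<le> 2 ^ N} \<in> convex_bodies_o"
    "max 1 (Y * V) \<le> dual_volume G {x. \<bar>x \<bullet> w\<bar> \<le> 1 \<and> norm x \<le> 2 ^ N}"
    using dual_volume_slab_ge[OF card G c0 w max.cobounded1] by blast
  define K where "K = {x. \<bar>x \<bullet> w\<bar> \<le> 1 \<and> norm x \<le> 2 ^ N}"
  define s where "s = dual_volume G K / V"
  have K: "K \<in> convex_bodies_o" using N(1) by (simp add: K_def)
  have Q: "0 < s" "(*\<^sub>R) s ` polar_body K \<in> normalized_bodies G"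
    unfolding s_def V_def using scaled_polar_in_normalized_bodies[OF card G c0 K] by blast+
  then have QK: "(*\<^sub>R) s ` polar_body K \<in> convex_bodies_o" by (simp add: normalized_bodies_def)
  have "Y * V \<le> dual_volume G K" using N(2) by (simp add: K_def)
  then have Y: "Y \<le> s" using V by (simp add: s_def pos_le_divide_eq)
  have "Y * \<bar>v \<bullet> w\<bar> \<le> support_fun ((*\<^sub>R) s ` polar_body K) v" for v
  proof -
    have "w \<in> polar_body K" "- w \<in> polar_body K"
      by (auto simp: polar_body_def K_def inner_commute abs_le_iff)
    then have "(s *\<^sub>R w) \<bullet> v \<le> support_fun ((*\<^sub>R) s ` polar_body K) v"
      "(s *\<^sub>R (- w)) \<bullet> v \<le> support_fun ((*\<^sub>R) s ` polar_body K) v"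
      using inner_le_support_fun[OF QK imageI] by blast+
    then have "\<bar>s * (v \<bullet> w)\<bar> \<le> support_fun ((*\<^sub>R) s ` polar_body K) v"
      by (simp add: inner_commute abs_le_iff)
    moreover have "\<bar>s * (v \<bullet> w)\<bar> = s * \<bar>v \<bullet> w\<bar>" using Q(1) by (simp add: abs_mult)
    moreover have "Y * \<bar>v \<bullet> w\<bar> \<le> s * \<bar>v \<bullet> w\<bar>" using Y by (simp add: mult_right_mono)
    ultimately show ?thesis by linarith
  qed
  then show ?thesis using Q(2) by blast
qed

text \<open>\<open>K k\<close> cuts out of the unit ball the cylinder of radius
  \<open>1 / Suc k\<close> around the axis through \<open>w\<close>. Its radial function is at most
  1 and tends to 0 off the two poles, so dominated convergence brings the integral at
  \<open>\<delta>\<close> below 1.\<close>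

lemma dual_volume_spindle_le:
  fixes G :: "real \<Rightarrow> real ^ 'n \<Rightarrow> real"
  assumes G: "G \<in> class_G_I" and w: "norm w = 1" and \<delta>: "0 < \<delta>"
  shows "\<exists>K\<in>convex_bodies_o. w \<in> K \<and> dual_volume G K \<le> \<delta>"
proof -
  define p where "p = (\<lambda>v::real ^ 'n. v - (v \<bullet> w) *\<^sub>R w)"
  define K where "K = (\<lambda>k::nat. {x. norm x \<le> 1 \<and> norm (real (Suc k) *\<^sub>R p x) \<le> 1})"
  \<comment> \<open>The gauge of \<open>K k\<close> restricted to the sphere, where the condition
    \<open>norm x \<le> 1\<close> contributes the entry 1.\<close>
  define N where "N = (\<lambda>k v. max 1 (real (Suc k) * norm (p v)))"
  have lin: "linear (\<lambda>x. real (Suc k) *\<^sub>R p x)" for k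
    by (rule linearI) (auto simp: p_def algebra_simps inner_add_left)
  have pw: "p w = 0" using w by (simp add: p_def norm_eq_1)
  have K: "K k \<in> convex_bodies_o" for k
  proof (rule convex_bodies_oI)
    have eq: "K k = cball 0 1 \<inter> (\<lambda>x. real (Suc k) *\<^sub>R p x) -` cball 0 1"
      by (auto simp: K_def)
    show "convex (K k)" unfolding eq by (intro convex_Int convex_linear_vimage lin) auto
    show "compact (K k)" unfolding eq p_def
      by (intro compact_Int_closed compact_cball closed_vimage continuous_intros closed_cball)
    show "0 < 1 / (2 * real (Suc k))" by simp
    show "ball 0 (1 / (2 * real (Suc k))) \<subseteq> K k"
    proof
      fix x :: "real ^ 'n" assume "x \<in> ball 0 (1 / (2 * real (Suc k)))"
      then have x: "2 * real (Suc k) * norm x < 1" by (simp add: field_simps)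
      have "norm (p x) \<le> norm x + norm ((x \<bullet> w) *\<^sub>R w)" unfolding p_def by (rule norm_triangle_ineq4)
      also have "\<dots> \<le> 2 * norm x" using Cauchy_Schwarz_ineq2[of x w] w by simp
      finally have "real (Suc k) * norm (p x) \<le> real (Suc k) * (2 * norm x)" by (intro mult_left_mono) auto
      moreover have "1 * norm x \<le> 2 * real (Suc k) * norm x" by (intro mult_right_mono) auto
      ultimately have "real (Suc k) * norm (p x) \<le> 1" "norm x \<le> 1" using x by linarith+
      then show "x \<in> K k" by (simp add: K_def)
    qed
  qed
  have rad: "radial_fun (K k) v = 1 / N k v" if "v \<in> sphere 0 1" for k v
  proof (rule radial_fun_eqI)
    show "0 < N k v" by (simp add: N_def)
    have "p (t *\<^sub>R v) = t *\<^sub>R p v" for t by (simp add: p_def algebra_simps)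
    then show "t *\<^sub>R v \<in> K k \<longleftrightarrow> t * N k v \<le> 1" if "0 \<le> t" for t
      using that \<open>v \<in> sphere 0 1\<close>
      by (simp add: K_def N_def max_mult_distrib_left mult_ac)
  qed
  have "(\<lambda>k. \<integral>\<^sup>+v. ennreal (G (1 / N k v / \<delta>) v) \<partial>spherical_measure) \<longlonglongrightarrow> 0"
  proof (rule nn_integral_class_G_I_tendsto_0[OF G])
    show "0 < 1 / \<delta>" using \<delta> by simp
    show "continuous_on (sphere 0 1) (\<lambda>v. 1 / N k v / \<delta>)" for k
      using \<delta> unfolding N_def p_def by (intro continuous_intros) auto
    show "0 < 1 / N k v / \<delta> \<and> 1 / N k v / \<delta> \<le> 1 / \<delta>" for k v
    proof -
      have "1 \<le> N k v" by (simp add: N_def)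
      then show ?thesis using \<delta> divide_right_mono[of "1 / N k v" 1 \<delta>] by simp
    qed
    show "finite {w, - w}" "{w, - w} \<subseteq> sphere 0 1" using w by auto
    fix v assume v: "v \<in> sphere 0 1 - {w, - w}"
    \<comment> \<open>\<open>p\<close> vanishes only on the axis, which meets the sphere in the two
      excluded poles.\<close>
    have pv: "0 < norm (p v)"
    proof (rule ccontr)
      assume "\<not> 0 < norm (p v)"
      then have eq: "v = (v \<bullet> w) *\<^sub>R w" by (simp add: p_def)
      then have "norm v = \<bar>v \<bullet> w\<bar>" using w by (metis norm_scaleR mult.right_neutral)
      then have "v \<bullet> w = 1 \<or> v \<bullet> w = - 1" using v by auto
      then show False using eq v by (metis DiffD2 insertI1 insertI2 scaleR_one scaleR_minus1_left)
    qed
    show "(\<lambda>k. 1 / N k v / \<delta>) \<longlonglongrightarrow> 0"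
    proof (rule real_tendsto_sandwich[where f = "\<lambda>k. 0"])
      show "(\<lambda>k. 1 / (norm (p v) * \<delta>) / real (Suc k)) \<longlonglongrightarrow> 0"
        by (rule LIMSEQ_Suc) (rule lim_const_over_n)
      show "\<forall>\<^sub>F k in sequentially. 0 \<le> 1 / N k v / \<delta>"
        using \<delta> by (simp add: N_def)
      have "1 / N k v / \<delta> \<le> 1 / (norm (p v) * \<delta>) / real (Suc k)" for k
      proof -
        have "1 / N k v \<le> 1 / (real (Suc k) * norm (p v))"
          using pv by (intro divide_left_mono mult_pos_pos) (auto simp: N_def)
        then have "1 / N k v / \<delta> \<le> 1 / (real (Suc k) * norm (p v)) / \<delta>"
          using \<delta> by (intro divide_right_mono) auto
        then show ?thesis by (simp add: mult_ac)
      qed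
      then show "\<forall>\<^sub>F k in sequentially. 1 / N k v / \<delta> \<le> 1 / (norm (p v) * \<delta>) / real (Suc k)" by simp
    qed simp_all
  qed
  then have "eventually (\<lambda>k. (\<integral>\<^sup>+v. ennreal (G (1 / N k v / \<delta>) v) \<partial>spherical_measure) < 1) sequentially"
    by (rule order_tendstoD) simp
  then obtain k where "(\<integral>\<^sup>+v. ennreal (G (1 / N k v / \<delta>) v) \<partial>spherical_measure) < 1"
    by (auto simp: eventually_sequentially)
  moreover have "dual_integral G (K k) \<delta> = (\<integral>\<^sup>+v. ennreal (G (1 / N k v / \<delta>) v) \<partial>spherical_measure)"
    unfolding dual_integral_def by (intro nn_integral_cong) (simp add: rad space_spherical_measure)
  ultimately have "dual_volume G (K k) \<le> \<delta>" using \<delta> by (intro dual_volume_le) auto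
  moreover have "w \<in> K k" using w pw by (simp add: K_def)
  ultimately show ?thesis using K by blast
qed

text \<open>As \<open>w\<close> lies in \<open>K\<close>, the polar lies in the half-space where the
  inner product with \<open>w\<close> is at most 1, so the scaled polar has support function at most
  \<open>s\<close> at \<open>w\<close>. A spindle of small dual volume makes \<open>s\<close>
  small.\<close>

lemma ex_normalized_body_support_fun_le:
  fixes G :: "real \<Rightarrow> real ^ 'n \<Rightarrow> real"
  assumes card: "2 \<le> CARD('n)" and G: "G \<in> class_G_I"
    and c0: "0 < c0" "\<forall>t\<ge>1. \<forall>v\<in>sphere 0 1. c0 * t \<le> G t v"
    and w: "norm w = 1" and e: "0 < e"
  shows "\<exists>Q\<in>normalized_bodies G. support_fun Q w \<le> e"
proof -
  define V where "V = dual_volume G (cball 0 1)"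
  have "cball 0 1 \<in> (convex_bodies_o :: (real ^ 'n) set set)"
    by (rule convex_bodies_oI[of _ 1]) auto
  then have V: "0 < V" unfolding V_def by (rule dual_volume_pos[OF card G c0])
  obtain K where K: "K \<in> convex_bodies_o" "w \<in> K" "dual_volume G K \<le> e * V"
    using dual_volume_spindle_le[OF G w, of "e * V"] e V by auto
  define s where "s = dual_volume G K / V"
  have Q: "0 < s" "(*\<^sub>R) s ` polar_body K \<in> normalized_bodies G"
    unfolding s_def V_def using scaled_polar_in_normalized_bodies[OF card G c0 K(1)] by blast+
  have "s \<le> e" using K(3) V by (simp add: s_def pos_divide_le_eq)
  have "0 \<in> polar_body K" by (simp add: polar_body_def)
  have "support_fun ((*\<^sub>R) s ` polar_body K) w \<le> s"
    unfolding support_fun_def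
  proof (rule cSUP_least)
    show "(*\<^sub>R) s ` polar_body K \<noteq> {}" using \<open>0 \<in> polar_body K\<close> by blast
    fix x assume "x \<in> (*\<^sub>R) s ` polar_body K"
    then obtain y where y: "x = s *\<^sub>R y" "y \<in> polar_body K" by blast
    then have "y \<bullet> w \<le> 1" using K(2) by (auto simp: polar_body_def)
    then show "x \<bullet> w \<le> s" using y(1) Q(1) by (simp add: mult_left_le)
  qed
  then show ?thesis using Q(2) \<open>s \<le> e\<close> by (meson order_trans)
qed

section \<open>Infimum and supremum over the normalized bodies\<close>

theorem proposition4p4:
  fixes G :: "real \<Rightarrow> real ^ 'n \<Rightarrow> real"
    and u :: "nat \<Rightarrow> real ^ 'n" and lam :: "nat \<Rightarrow> real" and m :: nat
    and q :: real
    and first :: 'n \<comment> \<open>the index of the first coordinate; index types carry no order\<close>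
  assumes "CARD('n) \<ge> 2"
    and "\<forall>i \<in> {1..m}. lam i > 0"
    and "u ` {1..m} \<subseteq> sphere 0 1"
    and "not_in_closed_hemisphere (u ` {1..m})"
    and "G \<in> class_G_I"
    and "q \<ge> real CARD('n) - 1"
    and "(INF (t, v) \<in> {1..} \<times> sphere 0 1. G t v / t powr q) > 0"
  shows "(\<forall>\<phi> \<in> class_D. (\<forall>i \<in> {1..m}. u i $ first \<noteq> 0) \<longrightarrow>
            (INF Q \<in> normalized_bodies G. ereal (\<Sum>i = 1..m. lam i * \<phi> (support_fun Q (u i)))) = 0)
       \<and> (\<forall>\<phi> \<in> class_I \<union> class_D.
            (SUP Q \<in> normalized_bodies G. ereal (\<Sum>i = 1..m. lam i * \<phi> (support_fun Q (u i)))) = \<infinity>)"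
proof -
  define c0 where "c0 = (INF (t, v) \<in> {1..} \<times> sphere 0 1. G t v / t powr q)"
  have c0: "0 < c0" using assms(7) by (simp add: c0_def)
  \<comment> \<open>Since \<open>q \<ge> CARD('n) - 1 \<ge> 1\<close>, the power
    \<open>t powr q\<close> is at least \<open>t\<close> for \<open>t \<ge> 1\<close>. Positivity of
    \<open>G\<close> bounds the quotients below, so the real infimum \<open>c0\<close> is a lower
    bound of them.\<close>
  have growth: "\<forall>t\<ge>1. \<forall>v\<in>sphere 0 1. c0 * t \<le> G t v"
  proof (intro allI ballI impI)
    fix t :: real and v :: "real ^ 'n"
    assume t: "1 \<le> t" and v: "v \<in> sphere 0 1"
    have "c0 \<le> (case (t, v) of (t, v) \<Rightarrow> G t v / t powr q)"
      unfolding c0_def using t v class_G_I_pos[OF assms(5)]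
      by (intro cINF_lower bdd_belowI2[of _ 0]) (auto intro!: divide_nonneg_nonneg less_imp_le)
    then have "c0 * t powr q \<le> G t v" using t by (simp add: pos_le_divide_eq)
    moreover have "t powr 1 \<le> t powr q"
      using t assms(1,6) by (intro powr_mono) auto
    then have "c0 * t \<le> c0 * t powr q" using t c0 by simp
    ultimately show "c0 * t \<le> G t v" by linarith
  qed
  note large = ex_normalized_body_support_fun_ge[OF assms(1) assms(5) c0 growth]
  note small = ex_normalized_body_support_fun_le[OF assms(1) assms(5) c0 growth]
  have sphere: "u i \<in> sphere 0 1" if "i \<in> {1..m}" for i using assms(3) that by blast
  have hpos: "0 < support_fun Q (u i)" if "Q \<in> normalized_bodies G" "i \<in> {1..m}" for Q i
    using that sphere by (intro support_fun_pos) (auto simp: normalized_bodies_def)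
  have phipos: "0 < \<phi> t" if "\<phi> \<in> class_I \<union> class_D" "0 < t" for \<phi> t
    using that by (auto simp: class_I_def class_D_def)
  have termpos: "0 < lam i * \<phi> (support_fun Q (u i))"
    if "\<phi> \<in> class_I \<union> class_D" "Q \<in> normalized_bodies G" "i \<in> {1..m}" for \<phi> Q i
    using that assms(2) hpos phipos by simp
  \<comment> \<open>An empty family would violate the hemisphere condition at any unit vector.
    Nonemptiness enters the minimum \<open>\<kappa>\<close>, the positivity of
    \<open>\<Lambda>\<close> and the choice of \<open>j\<close>.\<close>
  have ne: "{1..m} \<noteq> {}"
  proof
    assume "{1..m} = {}"
    moreover obtain v :: "real ^ 'n" where "norm v = 1" using vector_choose_size[of 1] by auto
    ultimately show False using assms(4) by (auto simp: not_in_closed_hemisphere_def)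
  qed
  show ?thesis
  proof (intro conjI ballI impI)
    fix \<phi> assume \<phi>: "\<phi> \<in> class_D" and nz: "\<forall>i\<in>{1..m}. u i $ first \<noteq> 0"
    \<comment> \<open>Inner products with this basis vector are the first coordinates. All are
      nonzero, so one slab direction makes every support value large at once.\<close>
    define w :: "real ^ 'n" where "w = axis first 1"
    have w: "norm w = 1" by (simp add: w_def)
    have uw: "u i \<bullet> w = u i $ first" for i by (simp add: w_def inner_axis)
    define \<kappa> where "\<kappa> = Min ((\<lambda>i. \<bar>u i $ first\<bar>) ` {1..m})"
    have \<kappa>: "0 < \<kappa>" "\<And>i. i \<in> {1..m} \<Longrightarrow> \<kappa> \<le> \<bar>u i $ first\<bar>"
      using nz ne by (auto simp: \<kappa>_def)
    define \<Lambda> where "\<Lambda> = (\<Sum>i = 1..m. lam i)"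
    have \<Lambda>: "0 < \<Lambda>" unfolding \<Lambda>_def using assms(2) ne by (intro sum_pos) auto
    show "(INF Q \<in> normalized_bodies G. ereal (\<Sum>i = 1..m. lam i * \<phi> (support_fun Q (u i)))) = 0"
    proof (rule antisym)
      show "0 \<le> (INF Q \<in> normalized_bodies G. ereal (\<Sum>i = 1..m. lam i * \<phi> (support_fun Q (u i))))"
      proof (rule INF_greatest)
        fix Q assume "Q \<in> normalized_bodies G"
        then have "0 \<le> (\<Sum>i = 1..m. lam i * \<phi> (support_fun Q (u i)))"
          using termpos[of \<phi>] \<phi> by (intro sum_nonneg less_imp_le) blast
        then show "0 \<le> ereal (\<Sum>i = 1..m. lam i * \<phi> (support_fun Q (u i)))" by simp
      qed
      show "(INF Q \<in> normalized_bodies G. ereal (\<Sum>i = 1..m. lam i * \<phi> (support_fun Q (u i)))) \<le> 0"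
      proof (rule ereal_le_epsilon2)
        fix e :: real assume e: "0 < e"
        have "(\<phi> \<longlongrightarrow> 0) at_top" using \<phi> by (simp add: class_D_def)
        then have "eventually (\<lambda>x. \<phi> x < e / \<Lambda>) at_top" using e \<Lambda> by (intro order_tendstoD) auto
        then obtain X where X: "\<And>x. X \<le> x \<Longrightarrow> \<phi> x < e / \<Lambda>" by (auto simp: eventually_at_top_linorder)
        \<comment> \<open>Multiplied by \<open>\<bar>u i \<bullet> w\<bar> \<ge> \<kappa>\<close>,
          this factor gives at least \<open>X\<close>; the maximum with 0 keeps it nonnegative, so
          that this multiplication is monotone.\<close>
        obtain Q where Q: "Q \<in> normalized_bodies G" "\<And>v. max X 0 / \<kappa> * \<bar>v \<bullet> w\<bar> \<le> support_fun Q v"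
          using large[OF w, of "max X 0 / \<kappa>"] by auto
        have "(\<Sum>i = 1..m. lam i * \<phi> (support_fun Q (u i))) \<le> (\<Sum>i = 1..m. lam i * (e / \<Lambda>))"
        proof (rule sum_mono)
          fix i assume i: "i \<in> {1..m}"
          have "X \<le> max X 0 / \<kappa> * \<kappa>" using \<kappa>(1) by simp
          also have "\<dots> \<le> max X 0 / \<kappa> * \<bar>u i \<bullet> w\<bar>"
            using \<kappa>(1) \<kappa>(2)[OF i] by (intro mult_left_mono) (auto simp: uw)
          also have "\<dots> \<le> support_fun Q (u i)" by (rule Q(2))
          finally have "\<phi> (support_fun Q (u i)) < e / \<Lambda>" by (rule X)
          then show "lam i * \<phi> (support_fun Q (u i)) \<le> lam i * (e / \<Lambda>)"
            using assms(2) i by (intro mult_left_mono) (auto intro: less_imp_le)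
        qed
        also have "\<dots> = e" using \<Lambda> by (simp add: \<Lambda>_def sum_distrib_right[symmetric] flip: sum_divide_distrib)
        finally have "ereal (\<Sum>i = 1..m. lam i * \<phi> (support_fun Q (u i))) \<le> 0 + ereal e" by simp
        then show "(INF Q \<in> normalized_bodies G. ereal (\<Sum>i = 1..m. lam i * \<phi> (support_fun Q (u i)))) \<le> 0 + ereal e"
          using Q(1) by (meson INF_lower2)
      qed
    qed
  next
    fix \<phi> assume \<phi>: "\<phi> \<in> class_I \<union> class_D"
    \<comment> \<open>All terms are positive, so it suffices to make one of them large: by a large
      support value for \<open>class_I\<close>, by a small one for \<open>class_D\<close>.\<close>
    obtain j where j: "j \<in> {1..m}" using ne by blast
    have l: "0 < lam j" and uj: "norm (u j) = 1" using assms(2) sphere j by auto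
    have "\<exists>Q\<in>normalized_bodies G. Z \<le> \<phi> (support_fun Q (u j))" for Z
    proof (cases "\<phi> \<in> class_I")
      case True
      then have "eventually (\<lambda>x. Z \<le> \<phi> x) at_top" by (simp add: class_I_def filterlim_at_top)
      then obtain X where X: "\<And>x. X \<le> x \<Longrightarrow> Z \<le> \<phi> x" by (auto simp: eventually_at_top_linorder)
      obtain Q where Q: "Q \<in> normalized_bodies G" "\<And>v. X * \<bar>v \<bullet> u j\<bar> \<le> support_fun Q v"
        using large[OF uj, of X] by auto
      have "X \<le> support_fun Q (u j)" using Q(2)[of "u j"] uj by (simp add: dot_square_norm)
      then show ?thesis using Q(1) X by blast
    next
      case False
      then have "eventually (\<lambda>x. Z \<le> \<phi> x) (at_right 0)"
        using \<phi> by (simp add: class_D_def filterlim_at_top)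
      then obtain b where b: "0 < b" "\<And>x. 0 < x \<Longrightarrow> x < b \<Longrightarrow> Z \<le> \<phi> x"
        by (auto simp: eventually_at_right_field)
      \<comment> \<open>Halving \<open>b\<close> supplies the strict inequality required by
        \<open>b(2)\<close>.\<close>
      obtain Q where Q: "Q \<in> normalized_bodies G" "support_fun Q (u j) \<le> b / 2"
        using small[OF uj, of "b / 2"] b(1) by auto
      have "Z \<le> \<phi> (support_fun Q (u j))" using b Q hpos[OF Q(1) j] by (intro b(2)) auto
      then show ?thesis using Q(1) by blast
    qed
    note ex = this
    show "(SUP Q \<in> normalized_bodies G. ereal (\<Sum>i = 1..m. lam i * \<phi> (support_fun Q (u i)))) = \<infinity>"
    proof (rule ereal_top)
      fix B :: real
      obtain Q where Q: "Q \<in> normalized_bodies G" "B / lam j \<le> \<phi> (support_fun Q (u j))" using ex by blast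
      have "B \<le> lam j * \<phi> (support_fun Q (u j))" using Q(2) l by (simp add: field_simps)
      also have "\<dots> \<le> (\<Sum>i = 1..m. lam i * \<phi> (support_fun Q (u i)))"
        using termpos[OF \<phi> Q(1)] j by (intro member_le_sum) (auto intro: less_imp_le)
      finally have "ereal B \<le> ereal (\<Sum>i = 1..m. lam i * \<phi> (support_fun Q (u i)))" by simp
      then show "ereal B \<le> (SUP Q \<in> normalized_bodies G. ereal (\<Sum>i = 1..m. lam i * \<phi> (support_fun Q (u i))))"
        using Q(1) by (meson SUP_upper2)
    qed
  qed
qed

end
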